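(* Let $X$ be a curve over a finite field with canonical divisor $K$, $D=P_1+\cdots+P_n$ a sum of $n$ distinct rational points and $G$ a divisor disjoint from $D$. Then \[ d(C_L(D,G))=\min\{\deg A : 0\leq A\leq D,\ L(A-C)\neq L(-C)\}\quad\text{for } C=D-G, \] \[ d(C_\Omega(D,G))=\min\{\deg A : 0\leq A\leq D,\ L(A-C)\neq L(-C)\}\quad\text{for } C=G-K. \]
   Context: $L(E)=\{f:(f)+E\ge0\}\cup\{0\}$, $\Omega(E)$ the differentials $\omega$ with $(\omega)\ge E$ together with $0$. $C_L(D,G)$ is the image of $L(G)\to\mathbb{F}^n$, $f\mapsto(f(P_1),\ldots,f(P_n))$; $C_\Omega(D,G)$ is the image of $\Omega(G-D)\to\mathbb{F}^n$, $\omega\mapsto(\mathrm{res}_{P_1}\omega,\ldots,\mathrm{res}_{P_n}\omega)$. $d(\cdot)$ denotes the minimum Hamming distance of a code. *)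

theory Defs
  imports
    "HOL-Library.Poly_Mapping"
    "HOL-Library.Extended_Nat"
    "HOL-Library.FuncSet"
    "HOL-Computational_Algebra.Polynomial"
begin

text \<open>
  A smooth projective absolutely irreducible curve over a field \<open>k\<close> is represented by its function
  field: an extension \<open>F\<close> of \<open>k\<close> (given by the embedding \<open>emb\<close> of \<open>k\<close> into \<open>F\<close>) that is finite
  over \<open>k(x)\<close> for some transcendental \<open>x\<close> and in which \<open>k\<close> is algebraically closed. For perfect \<open>k\<close>,
  the last condition says that the curve is absolutely irreducible. The closed points of
  the curve are the discrete valuations of \<open>F\<close> over \<open>k\<close>.
\<close>

section \<open>Function fields and points\<close>

definition algebraic_over :: "('k::field \<Rightarrow> 'a::field) \<Rightarrow> 'a \<Rightarrow> bool" where
  "algebraic_over emb x \<longleftrightarrow> (\<exists>p. p \<noteq> 0 \<and> poly (map_poly emb p) x = 0)"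

definition rational_functions_in :: "('k::field \<Rightarrow> 'a::field) \<Rightarrow> 'a \<Rightarrow> 'a set" where
  "rational_functions_in emb x =
     {poly (map_poly emb p) x / poly (map_poly emb q) x | p q. poly (map_poly emb q) x \<noteq> 0}"

locale curve_function_field =
  fixes emb :: "'k::field \<Rightarrow> 'a::field"
  assumes emb_one: "emb 1 = 1"
    and emb_add: "emb (a + b) = emb a + emb b"
    and emb_mult: "emb (a * b) = emb a * emb b"
    and one_variable:
      "\<exists>x. \<not> algebraic_over emb x \<and>
        (\<exists>B. finite B \<and>
          (\<forall>f. \<exists>c. (\<forall>b\<in>B. c b \<in> rational_functions_in emb x) \<and> f = (\<Sum>b\<in>B. c b * b)))"
    and full_constant_field: "algebraic_over emb f \<Longrightarrow> f \<in> range emb"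

text \<open>
  A point is identified with its normalized discrete valuation. The valuation of \<open>0\<close> is infinite;
  here it gets the dummy value \<open>0\<close>, so that every point corresponds to exactly one function.
\<close>

type_synonym 'a point = "'a \<Rightarrow> int"

definition points :: "('k::field \<Rightarrow> 'a::field) \<Rightarrow> 'a point set" where
  "points emb = {v.
     v 0 = 0 \<and>
     (\<forall>f g. f \<noteq> 0 \<longrightarrow> g \<noteq> 0 \<longrightarrow> v (f * g) = v f + v g) \<and>
     (\<forall>f g. f \<noteq> 0 \<longrightarrow> g \<noteq> 0 \<longrightarrow> f + g \<noteq> 0 \<longrightarrow> min (v f) (v g) \<le> v (f + g)) \<and>
     (\<forall>c. c \<noteq> 0 \<longrightarrow> v (emb c) = 0) \<and>
     (\<exists>t. t \<noteq> 0 \<and> v t = 1)}"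

definition local_ring :: "'a::field point \<Rightarrow> 'a set" where
  "local_ring P = {f. f = 0 \<or> P f \<ge> 0}"

definition maximal_ideal :: "'a::field point \<Rightarrow> 'a set" where
  "maximal_ideal P = {f. f = 0 \<or> P f > 0}"

text \<open>\<open>B\<close> represents a \<open>k\<close>-basis of the residue field \<open>local_ring P / maximal_ideal P\<close>.\<close>

definition residue_field_basis :: "('k::field \<Rightarrow> 'a::field) \<Rightarrow> 'a point \<Rightarrow> 'a set \<Rightarrow> bool" where
  "residue_field_basis emb P B \<longleftrightarrow>
     finite B \<and> B \<subseteq> local_ring P \<and>
     (\<forall>f \<in> local_ring P. \<exists>!c. c \<in> B \<rightarrow>\<^sub>E UNIV \<and> f - (\<Sum>b\<in>B. emb (c b) * b) \<in> maximal_ideal P)"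

definition point_degree :: "('k::field \<Rightarrow> 'a::field) \<Rightarrow> 'a point \<Rightarrow> nat" where
  "point_degree emb P = (THE d. \<exists>B. residue_field_basis emb P B \<and> card B = d)"

definition rational_points :: "('k::field \<Rightarrow> 'a::field) \<Rightarrow> 'a point set" where
  "rational_points emb =
     {P \<in> points emb. \<forall>f \<in> local_ring P. \<exists>c. f - emb c \<in> maximal_ideal P}"

definition value_at :: "('k::field \<Rightarrow> 'a::field) \<Rightarrow> 'a point \<Rightarrow> 'a \<Rightarrow> 'k" where
  "value_at emb P f = (THE c. f - emb c \<in> maximal_ideal P)"

section \<open>Divisors\<close>

type_synonym 'a divisor = "'a point \<Rightarrow>\<^sub>0 int"

definition is_divisor :: "('k::field \<Rightarrow> 'a::field) \<Rightarrow> 'a divisor \<Rightarrow> bool" where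
  "is_divisor emb E \<longleftrightarrow> Poly_Mapping.keys E \<subseteq> points emb"

text \<open>The order \<open>\<le>\<close> that the library puts on \<open>\<Rightarrow>\<^sub>0\<close> is not the pointwise one.\<close>

definition divisor_le :: "'a divisor \<Rightarrow> 'a divisor \<Rightarrow> bool" where
  "divisor_le E E' \<longleftrightarrow> (\<forall>P. Poly_Mapping.lookup E P \<le> Poly_Mapping.lookup E' P)"

definition divisor_degree :: "('k::field \<Rightarrow> 'a::field) \<Rightarrow> 'a divisor \<Rightarrow> int" where
  "divisor_degree emb E =
     (\<Sum>P\<in>Poly_Mapping.keys E. Poly_Mapping.lookup E P * int (point_degree emb P))"

definition points_divisor :: "'a point list \<Rightarrow> 'a divisor" where
  "points_divisor Ps = (\<Sum>P\<leftarrow>Ps. Poly_Mapping.single P 1)"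

definition riemann_roch_space :: "('k::field \<Rightarrow> 'a::field) \<Rightarrow> 'a divisor \<Rightarrow> 'a set" where
  "riemann_roch_space emb E =
     {f. f \<noteq> 0 \<longrightarrow> (\<forall>P \<in> points emb. P f + Poly_Mapping.lookup E P \<ge> 0)}"

section \<open>Differentials\<close>

text \<open>
  Kaehler differentials of \<open>F\<close> over \<open>k\<close>: the free \<open>F\<close>-module on symbols \<open>dz\<close>, where
  \<open>single z u\<close> stands for \<open>u dz\<close>, modulo the submodule generated by additivity, the Leibniz rule and
  \<open>dc = 0\<close> for constants. A differential is a coset of that submodule.
\<close>

definition kaehler_relations :: "('k::field \<Rightarrow> 'a::field) \<Rightarrow> ('a \<Rightarrow>\<^sub>0 'a) set" where
  "kaehler_relations emb = module.span (\<lambda>a. Poly_Mapping.map ((*) a))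
     ({Poly_Mapping.single (x + y) 1 - Poly_Mapping.single x 1 - Poly_Mapping.single y 1 | x y. True}
      \<union> {Poly_Mapping.single (x * y) 1 - Poly_Mapping.single y x - Poly_Mapping.single x y | x y. True}
      \<union> {Poly_Mapping.single (emb c) 1 | c. True})"

lemma module_poly_mapping:
  "module (\<lambda>a :: 'a::field. Poly_Mapping.map ((*) a) :: ('b \<Rightarrow>\<^sub>0 'a) \<Rightarrow> _)"
  by unfold_locales
    (auto intro!: poly_mapping_eqI simp: map.rep_eq lookup_add when_def algebra_simps
       add_eq_0_iff)

type_synonym 'a differential = "('a \<Rightarrow>\<^sub>0 'a) set"

definition kaehler_class :: "('k::field \<Rightarrow> 'a::field) \<Rightarrow> ('a \<Rightarrow>\<^sub>0 'a) \<Rightarrow> 'a differential" where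
  "kaehler_class emb w = {w'. w' - w \<in> kaehler_relations emb}"

definition differentials :: "('k::field \<Rightarrow> 'a::field) \<Rightarrow> 'a differential set" where
  "differentials emb = range (kaehler_class emb)"

definition zero_differential :: "('k::field \<Rightarrow> 'a::field) \<Rightarrow> 'a differential" where
  "zero_differential emb = kaehler_class emb 0"

text \<open>
  Order and residue of a differential at \<open>P\<close> are read off from \<open>\<omega> = u dt\<close> for a uniformizer \<open>t\<close>
  at \<open>P\<close>; neither depends on the choice of \<open>t\<close>.
\<close>

definition uniformizer :: "'a::field point \<Rightarrow> 'a" where
  "uniformizer P = (SOME t. t \<noteq> 0 \<and> P t = 1)"

definition local_coefficient ::
    "('k::field \<Rightarrow> 'a::field) \<Rightarrow> 'a point \<Rightarrow> 'a differential \<Rightarrow> 'a" where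
  "local_coefficient emb P \<omega> =
     (THE u. \<omega> = kaehler_class emb (Poly_Mapping.single (uniformizer P) u))"

definition differential_order ::
    "('k::field \<Rightarrow> 'a::field) \<Rightarrow> 'a point \<Rightarrow> 'a differential \<Rightarrow> int" where
  "differential_order emb P \<omega> = P (local_coefficient emb P \<omega>)"

text \<open>\<open>f = (\<Sum>i. c i * t ^ i)\<close> in the completion of \<open>F\<close> at a rational point \<open>P\<close> with uniformizer \<open>t\<close>.\<close>

definition laurent_expansion ::
    "('k::field \<Rightarrow> 'a::field) \<Rightarrow> 'a point \<Rightarrow> 'a \<Rightarrow> 'a \<Rightarrow> (int \<Rightarrow> 'k) \<Rightarrow> bool" where
  "laurent_expansion emb P t f c \<longleftrightarrow>
     (\<exists>m. (\<forall>i<m. c i = 0) \<and>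
       (\<forall>N\<ge>m. let r = f - (\<Sum>i=m..N. emb (c i) * t powi i) in r = 0 \<or> P r > N))"

definition residue_at ::
    "('k::field \<Rightarrow> 'a::field) \<Rightarrow> 'a point \<Rightarrow> 'a differential \<Rightarrow> 'k" where
  "residue_at emb P \<omega> =
     (THE c. laurent_expansion emb P (uniformizer P) (local_coefficient emb P \<omega>) c) (- 1)"

definition differential_space ::
    "('k::field \<Rightarrow> 'a::field) \<Rightarrow> 'a divisor \<Rightarrow> 'a differential set" where
  "differential_space emb E =
     {\<omega> \<in> differentials emb. \<omega> \<noteq> zero_differential emb \<longrightarrow>
        (\<forall>P \<in> points emb. differential_order emb P \<omega> \<ge> Poly_Mapping.lookup E P)}"

definition canonical_divisor :: "('k::field \<Rightarrow> 'a::field) \<Rightarrow> 'a divisor \<Rightarrow> bool" where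
  "canonical_divisor emb K \<longleftrightarrow> is_divisor emb K \<and>
     (\<exists>\<omega> \<in> differentials emb. \<omega> \<noteq> zero_differential emb \<and>
        (\<forall>P \<in> points emb. Poly_Mapping.lookup K P = differential_order emb P \<omega>))"

section \<open>Codes\<close>

definition hamming_distance :: "'k list \<Rightarrow> 'k list \<Rightarrow> nat" where
  "hamming_distance x y = card {i. i < length x \<and> x ! i \<noteq> y ! i}"

text \<open>The minimum over the empty set (for a code with only one word) is \<open>\<infinity>\<close>.\<close>

definition minimum_distance :: "'k list set \<Rightarrow> enat" where
  "minimum_distance C = Inf {enat (hamming_distance x y) | x y. x \<in> C \<and> y \<in> C \<and> x \<noteq> y}"

definition code_L :: "('k::field \<Rightarrow> 'a::field) \<Rightarrow> 'a point list \<Rightarrow> 'a divisor \<Rightarrow> 'k list set" where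
  "code_L emb Ps G = (\<lambda>f. map (\<lambda>P. value_at emb P f) Ps) ` riemann_roch_space emb G"

definition code_Omega :: "('k::field \<Rightarrow> 'a::field) \<Rightarrow> 'a point list \<Rightarrow> 'a divisor \<Rightarrow> 'k list set" where
  "code_Omega emb Ps G =
     (\<lambda>\<omega>. map (\<lambda>P. residue_at emb P \<omega>) Ps) ` differential_space emb (G - points_divisor Ps)"

end

theory Submission
  imports Defs "HOL-Computational_Algebra.Primes" "HOL-Computational_Algebra.Fraction_Field"
begin

text \<open>
  Let \<open>E = D - C\<close>, so that \<open>E = G\<close> for \<open>C\<^sub>L\<close> and \<open>E = D + K - G\<close> for \<open>C\<^sub>\<Omega>\<close>. A differential \<open>\<omega>\<^sub>0\<close>
  with divisor \<open>K\<close> gives an isomorphism \<open>f \<mapsto> f \<omega>\<^sub>0\<close> from \<open>L(D + K - G)\<close> to \<open>\<Omega>(G - D)\<close>, hence both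
  codes are images of \<open>L(E)\<close> under maps that read off, at each \<open>P\<^sub>i\<close>, the coefficient of the
  smallest order permitted by \<open>E\<close>. The word of \<open>f\<close> is supported in \<open>A \<le> D\<close> iff
  \<open>f \<in> L(A - C)\<close>, and it is zero iff \<open>f \<in> L(-C)\<close>.

  For the differentials one needs that \<open>dt\<close> is a basis of the Kaehler differentials whenever \<open>t\<close> is
  a uniformizer at some point. Let \<open>p\<close> be the characteristic. As \<open>k\<close> is perfect, \<open>[F : F ^ p] \<le> p\<close>,
  and \<open>1, t, \<dots>, t ^ (p - 1)\<close> are independent over \<open>F ^ p\<close> because their orders differ modulo \<open>p\<close>,
  so these powers form a basis of \<open>F\<close> over \<open>F ^ p\<close>. The \<open>F ^ p\<close>-linear map with
  \<open>t ^ i \<mapsto> i t ^ (i - 1)\<close> is a derivation \<open>D\<close> over \<open>k\<close>, which shows that \<open>dt\<close> is nonzero. The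
  identity \<open>dz = (D z) dt\<close> is \<open>F ^ p\<close>-linear in \<open>z\<close> and holds for the powers of \<open>t\<close>, so \<open>dt\<close>
  generates.
\<close>

section \<open>Field homomorphisms and towers of field extensions\<close>

locale comm_ring_hom = additive h for h :: "'a::comm_ring_1 \<Rightarrow> 'b::comm_ring_1" +
  assumes one: "h 1 = 1"
    and mult: "h (x * y) = h x * h y"
begin

lemma power: "h (x ^ n) = h x ^ n"
  by (induction n) (simp_all add: one mult)

lemma of_nat: "h (of_nat n) = of_nat n"
  by (induction n) (simp_all add: zero one add)

lemma comm_ring_hom_poly_map_poly: "comm_ring_hom (\<lambda>f. poly (map_poly h f) x)"
proof
  let ?ev = "\<lambda>f. poly (map_poly h f) x"
  have pCons: "?ev (pCons a f) = h a + x * ?ev f" for a f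
    by (simp add: map_poly_pCons zero)
  have smult: "?ev (smult a f) = h a * ?ev f" for a f
    by (induction f) (simp_all add: pCons mult algebra_simps)
  show ev_add: "?ev (f + g) = ?ev f + ?ev g" for f g
    by (induction f g rule: poly_induct2) (simp_all add: pCons add algebra_simps)
  show "?ev 1 = 1"
    by (simp add: one)
  show "?ev (f * g) = ?ev f * ?ev g" for f g
    by (induction f) (simp_all add: pCons ev_add smult zero algebra_simps)
qed

end

locale field_hom = comm_ring_hom h for h :: "'a::field \<Rightarrow> 'b::field"
begin

lemma eq_0_iff [simp]: "h x = 0 \<longleftrightarrow> x = 0"
  using mult [of x "inverse x"] by (cases "x = 0") (auto simp: zero one)

lemma inject: "h x = h y \<longleftrightarrow> x = y"
  using eq_0_iff [of "x - y"] by (simp add: diff)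

lemma CHAR_eq: "CHAR('b) = CHAR('a)"
  by (rule CHAR_eqI) (simp_all flip: of_nat add: of_nat_eq_0_iff_char_dvd)

sublocale extension: vector_space "\<lambda>a x. h a * x"
  by unfold_locales (simp_all add: add mult one algebra_simps)

declare extension.scale_scale [simp del] \<comment> \<open>undone by rewriting with \<open>mult\<close>\<close>

end

lemma field_hom_frobenius:
  assumes "prime CHAR('a::field)"
  shows "field_hom (\<lambda>x::'a. x ^ CHAR('a))"
  by unfold_locales (simp_all add: freshmans_dream [OF assms refl] power_mult_distrib)

definition fract_extension :: "('a::idom \<Rightarrow> 'b::field) \<Rightarrow> 'a fract \<Rightarrow> 'b" where
  "fract_extension h r = (THE z. \<exists>a b. b \<noteq> 0 \<and> r = Fract a b \<and> z = h a / h b)"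

locale idom_embedding = comm_ring_hom h for h :: "'a::idom \<Rightarrow> 'b::field" +
  assumes eq_0_imp: "h a = 0 \<Longrightarrow> a = 0"
begin

lemma fract_extension_Fract:
  assumes "b \<noteq> 0"
  shows "fract_extension h (Fract a b) = h a / h b"
  unfolding fract_extension_def
proof (rule the_equality)
  fix z assume "\<exists>a' b'. b' \<noteq> 0 \<and> Fract a b = Fract a' b' \<and> z = h a' / h b'"
  then obtain a' b' where b': "b' \<noteq> 0" and eq: "Fract a b = Fract a' b'" and z: "z = h a' / h b'"
    by blast
  have "h b \<noteq> 0" "h b' \<noteq> 0"
    using eq_0_imp assms b' by blast+
  moreover have "h a * h b' = h a' * h b"
    using eq assms b' by (simp add: eq_fract flip: mult)
  ultimately show "z = h a / h b"
    by (simp add: z field_simps)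
qed (use assms in blast)

lemma field_hom_fract_extension: "field_hom (fract_extension h)"
proof
  fix r s :: "'a fract"
  obtain a b where r: "r = Fract a b" "b \<noteq> 0"
    by (cases r)
  obtain c d where s: "s = Fract c d" "d \<noteq> 0"
    by (cases s)
  have "h b \<noteq> 0" "h d \<noteq> 0"
    using eq_0_imp r s by blast+
  then show "fract_extension h (r + s) = fract_extension h r + fract_extension h s"
    and "fract_extension h (r * s) = fract_extension h r * fract_extension h s"
    using r s by (simp_all add: fract_extension_Fract add mult field_simps)
  show "fract_extension h 1 = 1"
    by (simp add: One_fract_def fract_extension_Fract one)
qed

end

lemma (in vector_space) independent_family:
  assumes fin: "finite I"
    and coeff_0: "\<And>u i. (\<Sum>i\<in>I. scale (u i) (f i)) = 0 \<Longrightarrow> i \<in> I \<Longrightarrow> u i = 0"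
  shows "inj_on f I" and "independent (f ` I)"
proof -
  show inj: "inj_on f I"
  proof (rule inj_onI, rule ccontr)
    fix i j assume ij: "i \<in> I" "j \<in> I" "f i = f j" "i \<noteq> j"
    define u :: "'c \<Rightarrow> 'a" where "u l = (if l = i then 1 else 0) - (if l = j then 1 else 0)" for l
    have "(\<Sum>l\<in>I. scale (u l) (f l)) =
        (\<Sum>l\<in>I. if l = i then f l else 0) - (\<Sum>l\<in>I. if l = j then f l else 0)"
      unfolding u_def scale_left_diff_distrib sum_subtractf
      by (intro arg_cong2 [where f = minus] sum.cong) auto
    also have "\<dots> = 0"
      using fin ij by simp
    finally have "u i = 0"
      using ij by (intro coeff_0)
    with ij show False
      by (simp add: u_def)
  qed
  show "independent (f ` I)"
  proof (rule independent_if_scalars_zero)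
    fix u v assume "(\<Sum>x\<in>f ` I. scale (u x) x) = 0" "v \<in> f ` I"
    then show "u v = 0"
      using coeff_0 [of "\<lambda>i. u (f i)"] by (auto simp: sum.reindex [OF inj])
  qed (use fin in simp)
qed

locale restriction_of_scalars = field_hom h + vector_space scale
  for h :: "'k::field \<Rightarrow> 'l::field" and scale :: "'l \<Rightarrow> 'v::ab_group_add \<Rightarrow> 'v"
begin

sublocale restricted: vector_space "\<lambda>r. scale (h r)"
  by unfold_locales (simp_all add: add mult one scale_left_distrib scale_right_distrib)

lemma span_products:
  assumes S: "extension.span S = UNIV" and T: "span T = UNIV"
  shows "restricted.span ((\<lambda>(s, t). scale s t) ` (S \<times> T)) = UNIV" (is "?V = UNIV")
proof -
  have scale_T: "scale a t \<in> ?V" if "t \<in> T" for a t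
  proof -
    have "a \<in> extension.span S"
      by (simp add: S)
    then show ?thesis
    proof (induction rule: extension.span_induct)
      case base
      show ?case
        by (rule extension.subspaceI)
          (auto simp: scale_left_distrib simp flip: scale_scale
            intro: restricted.span_zero restricted.span_add restricted.span_scale)
    next
      case (step s)
      then show ?case
        using that by (intro restricted.span_base) auto
    qed
  qed
  have "v \<in> ?V" for v
  proof -
    have "v \<in> span T"
      by (simp add: T)
    then show ?thesis
      by (induction rule: span_induct_alt)
        (auto intro: restricted.span_zero restricted.span_add scale_T)
  qed
  then show ?thesis
    by blast
qed

lemma independent_products:
  assumes fin: "finite S" "finite T"
    and S: "extension.independent S" and T: "independent T"
  shows "inj_on (\<lambda>(s, t). scale s t) (S \<times> T)"
    and "restricted.independent ((\<lambda>(s, t). scale s t) ` (S \<times> T))"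
proof -
  have "u (s, t) = 0"
    if sum_0: "(\<Sum>x\<in>S \<times> T. scale (h (u x)) (case x of (s, t) \<Rightarrow> scale s t)) = 0"
      and "s \<in> S" "t \<in> T" for u s t
  proof -
    have "(\<Sum>x\<in>S \<times> T. scale (h (u x)) (case x of (s, t) \<Rightarrow> scale s t)) =
        (\<Sum>s\<in>S. \<Sum>t\<in>T. scale (h (u (s, t)) * s) t)"
      by (simp add: sum.cartesian_product case_prod_unfold)
    also have "\<dots> = (\<Sum>t\<in>T. scale (\<Sum>s\<in>S. h (u (s, t)) * s) t)"
      by (subst sum.swap) (simp add: scale_sum_left)
    finally have "(\<Sum>s\<in>S. h (u (s, t)) * s) = 0"
      using sum_0 independentD [OF T \<open>finite T\<close> order_refl] \<open>t \<in> T\<close> by simp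
    then show ?thesis
      using extension.independentD [OF S \<open>finite S\<close> order_refl, of "\<lambda>s. u (s, t)"] \<open>s \<in> S\<close>
      by blast
  qed
  then show "inj_on (\<lambda>(s, t). scale s t) (S \<times> T)"
    and "restricted.independent ((\<lambda>(s, t). scale s t) ` (S \<times> T))"
    using fin restricted.independent_family [of "S \<times> T" "\<lambda>(s, t). scale s t"] by auto
qed

end

text \<open>
  Both sides of \<open>[L : \<tau> L] [\<tau> L : \<tau> (h K)] = [L : h K] [h K : h (\<sigma> K)]\<close> are the degree of \<open>L\<close> over
  \<open>\<tau> (h K) = h (\<sigma> K)\<close>, and \<open>[\<tau> L : \<tau> (h K)] = [L : h K]\<close> cancels.
\<close>

lemma independent_card_le_of_commuting_homs:
  fixes h :: "'k::field \<Rightarrow> 'l::field"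
  assumes h: "field_hom h" and \<sigma>: "field_hom \<sigma>" and \<tau>: "field_hom \<tau>"
    and commute: "\<And>r. h (\<sigma> r) = \<tau> (h r)"
    and finite_extension: "finite B" "module.span (\<lambda>r a. h r * a) B = UNIV"
    and S: "finite S" "module.span (\<lambda>r a. \<sigma> r * a) S = UNIV"
    and T: "\<not> module.dependent (\<lambda>a b. \<tau> a * b) T"
  shows "finite T \<and> card T \<le> card S"
proof (rule finite_if_finite_subsets_card_bdd)
  interpret h: field_hom h by (rule h)
  interpret \<sigma>: field_hom \<sigma> by (rule \<sigma>)
  interpret \<tau>: field_hom \<tau> by (rule \<tau>)
  interpret via_L: restriction_of_scalars h "\<lambda>a b. \<tau> a * b" ..
  interpret via_K: restriction_of_scalars \<sigma> "\<lambda>r a. h r * a" ..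
  obtain C where C: "h.extension.independent C" "UNIV \<subseteq> h.extension.span C"
    using h.extension.maximal_independent_subset by blast
  then have span_C: "h.extension.span C = UNIV" and fin_C: "finite C"
    using h.extension.independent_span_bound [of B C] finite_extension by auto
  have "C \<noteq> {}"
    using span_C h.extension.span_empty by (metis UNIV_I singletonD zero_neq_one)
  fix T' assume T': "T' \<subseteq> T" "finite T'"
  have indep_T': "\<tau>.extension.independent T'"
    by (rule \<tau>.extension.independent_mono [OF T T'(1)])
  let ?TC = "(\<lambda>(c, t). \<tau> c * t) ` (C \<times> T')" and ?SC = "(\<lambda>(s, c). h s * c) ` (S \<times> C)"
  have "via_K.restricted.span ?SC = UNIV"
    by (rule via_K.span_products [OF S(2) span_C])
  moreover have "via_K.restricted.independent ?TC"
    using via_L.independent_products(2) [OF fin_C \<open>finite T'\<close> C(1) indep_T'] by (simp add: commute)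
  ultimately have "card ?TC \<le> card ?SC"
    using S fin_C via_K.restricted.independent_span_bound [of ?SC ?TC] by simp
  also have "\<dots> \<le> card S * card C"
    using S fin_C card_image_le [of "S \<times> C"] by (simp add: card_cartesian_product)
  also have "card ?TC = card C * card T'"
    using via_L.independent_products(1) [OF fin_C \<open>finite T'\<close> C(1) indep_T']
    by (simp add: card_image card_cartesian_product)
  finally show "card T' \<le> card S"
    using \<open>C \<noteq> {}\<close> fin_C by (simp add: mult.commute card_gt_0_iff)
qed

lemma surj_frobenius_finite_field: "surj (\<lambda>x :: 'k :: {field, finite}. x ^ CHAR('k))"
proof -
  have "prime CHAR('k)"
    by (rule prime_CHAR_semidom [OF finite_imp_CHAR_pos]) simp
  then interpret field_hom "\<lambda>x :: 'k. x ^ CHAR('k)"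
    by (rule field_hom_frobenius)
  show ?thesis
    by (rule finite_UNIV_inj_surj) (simp_all add: inj_def inject)
qed

context
  fixes x :: "'a::field"
  assumes prime: "prime CHAR('a)"
begin

interpretation frobenius: field_hom "\<lambda>a :: 'a. a ^ CHAR('a)"
  using prime by (rule field_hom_frobenius)

private abbreviation powers_span :: "'a set" where
  "powers_span \<equiv> frobenius.extension.span ((\<lambda>i. x ^ i) ` {..<CHAR('a)})"

private lemma power_in_span: "i < CHAR('a) \<Longrightarrow> x ^ i \<in> powers_span"
  by (intro frobenius.extension.span_base) blast

private lemma frobenius_in_span: "a ^ CHAR('a) \<in> powers_span"
  using frobenius.extension.span_scale [OF power_in_span [of 0], of a] prime prime_gt_0_nat by simp

private lemma times_generator_in_span:
  assumes "z \<in> powers_span"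
  shows "x * z \<in> powers_span"
  using assms
proof (induction rule: frobenius.extension.span_induct)
  case base
  show ?case
    by (rule frobenius.extension.subspaceI)
      (auto simp: distrib_left mult.left_commute [of x]
        intro: frobenius.extension.span_zero frobenius.extension.span_add
          frobenius.extension.span_scale)
next
  case (step z)
  then obtain i where z: "z = x ^ i" "i < CHAR('a)"
    by blast
  then consider "Suc i < CHAR('a)" | "Suc i = CHAR('a)"
    by linarith
  then show ?case
  proof cases
    case 1
    with power_in_span [of "Suc i"] show ?thesis
      by (simp add: z)
  next
    case 2
    with frobenius_in_span [of x] show ?thesis
      by (simp add: z flip: power_Suc)
  qed
qed

lemma poly_in_frobenius_span:
  assumes "\<And>n. coeff f n \<in> range (\<lambda>z. z ^ CHAR('a))"
  shows "poly f x \<in> module.span (\<lambda>a z. a ^ CHAR('a) * z) ((\<lambda>i. x ^ i) ` {..<CHAR('a)})"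
  using assms
proof (induction f)
  case 0
  show ?case
    using frobenius.extension.span_zero by simp
next
  case (pCons a f)
  have "a \<in> powers_span"
    using pCons.prems [of 0] frobenius_in_span by auto
  moreover have "poly f x \<in> powers_span"
    using pCons.prems [of "Suc _"] by (intro pCons.IH) simp
  ultimately show ?case
    by (simp add: frobenius.extension.span_add times_generator_in_span)
qed

end

lemma comm_ring_hom_Fract: "comm_ring_hom (\<lambda>a. Fract a 1)"
  by unfold_locales (simp_all add: One_fract_def)

lemma field_hom_Fract_const: "field_hom (\<lambda>c :: 'k::field. Fract [:c:] 1)"
  by unfold_locales (simp_all add: One_fract_def one_pCons mult.commute)

lemma Fract_poly_eq_poly_map_poly:
  fixes f :: "'k::field poly"
  shows "Fract f 1 = poly (map_poly (\<lambda>c. Fract [:c:] 1) f) (Fract [:0, 1:] 1)"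
proof (induction f)
  case 0
  show ?case
    by (simp add: Zero_fract_def)
next
  case (pCons a f)
  have "Fract (pCons a f) 1 = Fract [:a:] 1 + Fract [:0, 1:] 1 * Fract f 1"
    by simp
  with pCons.IH show ?case
    by (simp add: map_poly_pCons Zero_fract_def del: add_fract mult_fract)
qed

lemma span_powers_fract_poly:
  assumes prime: "prime CHAR('k::field)" and perfect: "surj (\<lambda>c :: 'k. c ^ CHAR('k))"
  shows "module.span (\<lambda>r z. r ^ CHAR('k) * z)
    ((\<lambda>i. Fract [:0, 1:] 1 ^ i) ` {..<CHAR('k)}) = (UNIV :: 'k poly fract set)"
    (is "?S = _")
proof -
  interpret embed: comm_ring_hom "\<lambda>f :: 'k poly. Fract f 1"
    by (rule comm_ring_hom_Fract)
  interpret const: field_hom "\<lambda>c :: 'k. Fract [:c:] 1"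
    by (rule field_hom_Fract_const)
  note CHAR = const.CHAR_eq [symmetric]
  interpret frobenius: field_hom "\<lambda>r :: 'k poly fract. r ^ CHAR('k)"
    using prime unfolding CHAR by (rule field_hom_frobenius)
  have embed_in: "Fract f 1 \<in> ?S" for f
    unfolding CHAR Fract_poly_eq_poly_map_poly [of f]
  proof (rule poly_in_frobenius_span)
    fix n
    obtain d where "coeff f n = d ^ CHAR('k)"
      using perfect by blast
    then have "coeff (map_poly (\<lambda>c. Fract [:c:] 1) f) n = Fract [:d:] 1 ^ CHAR('k poly fract)"
      by (simp add: coeff_map_poly Zero_fract_def const.power CHAR)
    then show "coeff (map_poly (\<lambda>c. Fract [:c:] 1) f) n \<in> range (\<lambda>z. z ^ CHAR('k poly fract))"
      by blast
  qed (use prime CHAR in simp)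
  have "r \<in> ?S" for r
  proof -
    obtain f g where "r = Fract f g" "g \<noteq> 0"
      by (cases r)
    then have r: "r = Fract f 1 / Fract g 1" and g: "Fract g 1 \<noteq> 0"
      by (simp_all add: Zero_fract_def eq_fract)
    have "r = (1 / Fract g 1) ^ CHAR('k) * (Fract f 1 * Fract g 1 ^ (CHAR('k) - 1))"
      using g prime_gt_0_nat [OF prime]
      by (simp add: r power_one_over field_simps del: divide_fract mult_fract flip: power_Suc)
    also have "\<dots> = (1 / Fract g 1) ^ CHAR('k) * Fract (f * g ^ (CHAR('k) - 1)) 1"
      by (simp only: embed.mult embed.power)
    also have "\<dots> \<in> ?S"
      by (intro frobenius.extension.span_scale embed_in)
    finally show ?thesis .
  qed
  then show ?thesis
    by blast
qed

section \<open>Orders and values at points\<close>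

definition order_ge :: "'a::field point \<Rightarrow> int \<Rightarrow> 'a \<Rightarrow> bool" where
  "order_ge P n f \<longleftrightarrow> f = 0 \<or> n \<le> P f"

lemma order_ge_0 [simp]: "order_ge P n 0"
  by (simp add: order_ge_def)

lemma order_ge_mono: "order_ge P n f \<Longrightarrow> m \<le> n \<Longrightarrow> order_ge P m f"
  by (auto simp: order_ge_def)

lemma local_ring_iff: "f \<in> local_ring P \<longleftrightarrow> order_ge P 0 f"
  by (simp add: local_ring_def order_ge_def)

lemma maximal_ideal_iff: "f \<in> maximal_ideal P \<longleftrightarrow> order_ge P 1 f"
  by (auto simp: maximal_ideal_def order_ge_def)

lemma riemann_roch_space_iff:
  "f \<in> riemann_roch_space emb E \<longleftrightarrow>
     (\<forall>P \<in> points emb. order_ge P (- Poly_Mapping.lookup E P) f)"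
  by (force simp: riemann_roch_space_def order_ge_def)

lemma
  assumes "P \<in> points emb"
  shows point_mult: "f \<noteq> 0 \<Longrightarrow> g \<noteq> 0 \<Longrightarrow> P (f * g) = P f + P g"
    and point_add: "f \<noteq> 0 \<Longrightarrow> g \<noteq> 0 \<Longrightarrow> f + g \<noteq> 0 \<Longrightarrow> min (P f) (P g) \<le> P (f + g)"
    and point_emb: "c \<noteq> 0 \<Longrightarrow> P (emb c) = 0"
    and ex_uniformizer: "\<exists>t. t \<noteq> 0 \<and> P t = 1"
  using assms unfolding points_def by blast+

lemma uniformizer:
  assumes "P \<in> points emb"
  shows "uniformizer P \<noteq> 0" "P (uniformizer P) = 1"
  using someI_ex [OF ex_uniformizer [OF assms]] by (auto simp: uniformizer_def)

lemma rational_point_is_point: "P \<in> rational_points emb \<Longrightarrow> P \<in> points emb"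
  by (simp add: rational_points_def)

sublocale curve_function_field \<subseteq> emb: field_hom emb
  by unfold_locales (fact emb_add emb_one emb_mult)+

context curve_function_field
begin

context
  fixes P
  assumes P: "P \<in> points emb"
begin

lemma point_1: "P 1 = 0"
  using point_emb [OF P, of 1] by (simp add: emb_one)

lemma point_minus: "P (- f) = P f"
  using point_mult [OF P, of "emb (- 1)" f] point_emb [OF P, of "- 1"]
  by (cases "f = 0") (auto simp: emb.minus emb_one)

lemma point_power: "f \<noteq> 0 \<Longrightarrow> P (f ^ n) = int n * P f"
  by (induction n) (simp_all add: point_1 point_mult [OF P] algebra_simps)

lemma point_inverse: "f \<noteq> 0 \<Longrightarrow> P (inverse f) = - P f"
  using point_mult [OF P, of f "inverse f"] by (simp add: point_1)

lemma point_powi: "f \<noteq> 0 \<Longrightarrow> P (f powi i) = i * P f"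
  by (simp add: power_int_def point_power point_inverse)

lemma order_ge_add: "order_ge P n f \<Longrightarrow> order_ge P n g \<Longrightarrow> order_ge P n (f + g)"
  using point_add [OF P, of f g] by (fastforce simp: order_ge_def)

lemma order_ge_minus: "order_ge P n (- f) \<longleftrightarrow> order_ge P n f"
  by (simp add: order_ge_def point_minus)

lemma order_ge_diff: "order_ge P n f \<Longrightarrow> order_ge P n g \<Longrightarrow> order_ge P n (f - g)"
  using order_ge_add [of n f "- g"] by (simp add: order_ge_minus)

lemma order_ge_sum: "(\<And>i. i \<in> I \<Longrightarrow> order_ge P n (f i)) \<Longrightarrow> order_ge P n (sum f I)"
  by (induction I rule: infinite_finite_induct) (simp_all add: order_ge_add)

lemma order_ge_mult_iff: "h \<noteq> 0 \<Longrightarrow> order_ge P n (f * h) \<longleftrightarrow> order_ge P (n - P h) f"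
  by (cases "f = 0") (auto simp: order_ge_def point_mult [OF P])

lemma order_ge_emb_mult: "order_ge P n f \<Longrightarrow> order_ge P n (emb c * f)"
  by (cases "c = 0 \<or> f = 0") (auto simp: order_ge_def point_mult [OF P] point_emb [OF P])

lemma order_ge_emb_pos: "n > 0 \<Longrightarrow> order_ge P n (emb c) \<longleftrightarrow> c = 0"
  using point_emb [OF P, of c] by (cases "c = 0") (auto simp: order_ge_def)

lemma sum_nonzero_of_distinct_orders:
  assumes fin: "finite I" "I \<noteq> {}"
    and nonzero: "\<And>i. i \<in> I \<Longrightarrow> f i \<noteq> 0"
    and distinct: "inj_on (\<lambda>i. P (f i)) I"
  shows "sum f I \<noteq> 0"
proof
  assume sum_0: "sum f I = 0"
  obtain j where j: "j \<in> I" "\<And>i. i \<in> I \<Longrightarrow> P (f j) \<le> P (f i)"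
    using arg_min_if_finite [OF fin, of "\<lambda>i. P (f i)"] by (metis linorder_not_less)
  have "order_ge P (P (f j) + 1) (sum f (I - {j}))"
  proof (rule order_ge_sum)
    fix i assume i: "i \<in> I - {j}"
    then have "P (f i) \<noteq> P (f j)"
      using distinct j by (auto dest: inj_onD)
    with i j(2) [of i] show "order_ge P (P (f j) + 1) (f i)"
      by (simp add: order_ge_def)
  qed
  moreover have "sum f (I - {j}) = - f j"
    using sum_0 fin j by (simp add: sum.remove eq_neg_iff_add_eq_0 add.commute)
  ultimately show False
    using nonzero [OF j(1)] by (simp add: order_ge_minus) (simp add: order_ge_def)
qed

lemma value_at_eqI:
  assumes "order_ge P 1 (f - emb c)"
  shows "value_at emb P f = c"
  unfolding value_at_def maximal_ideal_iff
proof (rule the_equality)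
  fix d assume "order_ge P 1 (f - emb d)"
  from order_ge_diff [OF assms this] have "order_ge P 1 (emb (d - c))"
    by (simp add: emb.diff)
  then show "d = c"
    by (simp add: order_ge_emb_pos)
qed (fact assms)

end

context
  fixes P
  assumes rational: "P \<in> rational_points emb"
begin

private lemmas P = rational_point_is_point [OF rational]

lemma value_at:
  assumes "order_ge P 0 f"
  shows "order_ge P 1 (f - emb (value_at emb P f))"
proof -
  from rational assms obtain c where c: "order_ge P 1 (f - emb c)"
    by (auto simp: rational_points_def local_ring_iff maximal_ideal_iff Ball_def)
  with value_at_eqI [OF P c] show ?thesis
    by simp
qed

lemma order_ge_minus_emb_iff:
  assumes "order_ge P 0 f"
  shows "order_ge P 1 (f - emb c) \<longleftrightarrow> value_at emb P f = c"
  using value_at [OF assms] value_at_eqI [OF P] by blast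

lemma value_at_eq_0_iff: "order_ge P 0 f \<Longrightarrow> value_at emb P f = 0 \<longleftrightarrow> order_ge P 1 f"
  using order_ge_minus_emb_iff [of f 0] by (simp add: emb.zero)

lemma value_at_emb_mult:
  assumes "order_ge P 0 f"
  shows "value_at emb P (emb c * f) = c * value_at emb P f"
  using order_ge_emb_mult [OF P value_at [OF assms], of c]
  by (intro value_at_eqI [OF P]) (simp add: emb_mult right_diff_distrib)

lemma value_at_diff:
  assumes "order_ge P 0 f" "order_ge P 0 g"
  shows "value_at emb P (f - g) = value_at emb P f - value_at emb P g"
  using order_ge_diff [OF P value_at [OF assms(1)] value_at [OF assms(2)]]
  by (intro value_at_eqI [OF P]) (simp add: emb.diff algebra_simps)

lemma value_at_sum:
  assumes "\<And>i. i \<in> I \<Longrightarrow> order_ge P 0 (f i)"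
  shows "value_at emb P (sum f I) = (\<Sum>i\<in>I. value_at emb P (f i))"
proof (rule value_at_eqI [OF P])
  show "order_ge P 1 (sum f I - emb (\<Sum>i\<in>I. value_at emb P (f i)))"
    using order_ge_sum [OF P value_at [OF assms]] by (simp add: emb.sum sum_subtractf)
qed

lemma minus_combination_in_maximal_ideal_iff:
  assumes "\<And>b. b \<in> B \<Longrightarrow> order_ge P 0 b"
  shows "emb a - (\<Sum>b\<in>B. emb (c b) * b) \<in> maximal_ideal P \<longleftrightarrow> (\<Sum>b\<in>B. c b * value_at emb P b) = a"
proof -
  let ?f = "\<Sum>b\<in>B. emb (c b) * b"
  have "order_ge P 0 ?f"
    using assms by (intro order_ge_sum [OF P] order_ge_emb_mult [OF P])
  then have "order_ge P 1 (?f - emb a) \<longleftrightarrow> (\<Sum>b\<in>B. c b * value_at emb P b) = a"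
    using assms
    by (simp add: order_ge_minus_emb_iff value_at_sum value_at_emb_mult order_ge_emb_mult [OF P])
  then show ?thesis
    using order_ge_minus [OF P, of 1 "?f - emb a"] by (simp add: maximal_ideal_iff)
qed

text \<open>The values of the elements of a basis form a basis of the one-dimensional \<open>k\<close>-space \<open>k\<close>.\<close>

lemma card_residue_field_basis_rational:
  assumes B: "residue_field_basis emb P B"
  shows "card B = 1"
proof -
  define combination where "combination c = (\<Sum>b\<in>B. c b * value_at emb P b)" for c
  have fin: "finite B" and regular: "\<And>b. b \<in> B \<Longrightarrow> order_ge P 0 b"
    using B by (auto simp: residue_field_basis_def local_ring_iff)
  have in_maximal_ideal_iff:
    "emb a - (\<Sum>b\<in>B. emb (c b) * b) \<in> maximal_ideal P \<longleftrightarrow> combination c = a" for a c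
    unfolding combination_def by (rule minus_combination_in_maximal_ideal_iff [OF regular])
  have unique: "\<exists>!c. c \<in> B \<rightarrow>\<^sub>E UNIV \<and> combination c = a" for a
  proof -
    have "emb a \<in> local_ring P"
      using order_ge_emb_mult [OF P, of 0 1 a] point_1 [OF P]
      by (simp add: local_ring_iff order_ge_def)
    then show ?thesis
      using B unfolding residue_field_basis_def in_maximal_ideal_iff [symmetric] by blast
  qed
  have coefficients_0: "c b = 0" if "combination c = 0" "b \<in> B" for c b
  proof -
    have "combination (restrict c B) = 0" "combination (\<lambda>x\<in>B. 0) = 0"
      using that by (simp_all add: combination_def)
    moreover have "restrict c B \<in> B \<rightarrow>\<^sub>E UNIV" "(\<lambda>x\<in>B. 0) \<in> B \<rightarrow>\<^sub>E UNIV"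
      by simp_all
    ultimately have "restrict c B = (\<lambda>x\<in>B. 0)"
      using unique [of 0] by blast
    then show ?thesis
      using that by (metis restrict_apply')
  qed
  interpret self: vector_space "(*) :: 'k \<Rightarrow> 'k \<Rightarrow> 'k"
    by unfold_locales (simp_all add: algebra_simps)
  have "inj_on (value_at emb P) B" "self.independent (value_at emb P ` B)"
    using self.independent_family [OF fin, of "value_at emb P"] coefficients_0
    by (simp_all add: combination_def)
  then have "card B \<le> 1"
    using self.independent_span_bound [of "{1}" "value_at emb P ` B"]
    by (simp add: card_image self.span_singleton)
  moreover have "B \<noteq> {}"
    using unique [of 1] by (auto simp: combination_def)
  ultimately show ?thesis
    using fin by (simp add: le_Suc_eq)
qed

lemma point_degree_rational: "point_degree emb P = 1"
  unfolding point_degree_def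
proof (rule the_equality)
  have "c \<in> {1} \<rightarrow>\<^sub>E UNIV \<and> f - (\<Sum>b\<in>{1}. emb (c b) * b) \<in> maximal_ideal P
      \<longleftrightarrow> c = (\<lambda>x\<in>{1}. value_at emb P f)" if "f \<in> local_ring P" for f c
    using order_ge_minus_emb_iff [of f "c 1"] that
    by (auto simp: maximal_ideal_iff local_ring_iff PiE_def extensional_def fun_eq_iff)
  then have "residue_field_basis emb P {1}"
    by (auto simp: residue_field_basis_def local_ring_iff order_ge_def point_1 [OF P])
  then show "\<exists>B. residue_field_basis emb P B \<and> card B = 1"
    by (intro exI [of _ "{1}"]) simp
qed (use card_residue_field_basis_rational in blast)

end

end

section \<open>Evaluation codes\<close>

lemma hamming_distance_map:
  assumes "distinct xs"
  shows "hamming_distance (map f xs) (map g xs) = card {x \<in> set xs. f x \<noteq> g x}"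
proof -
  let ?I = "{i. i < length xs \<and> f (xs ! i) \<noteq> g (xs ! i)}"
  have "{x \<in> set xs. f x \<noteq> g x} = (!) xs ` ?I"
    by (auto simp: in_set_conv_nth)
  moreover have "inj_on ((!) xs) ?I"
    using assms by (auto simp: inj_on_def nth_eq_iff_index_eq)
  ultimately have "card {x \<in> set xs. f x \<noteq> g x} = card ?I"
    by (simp add: card_image)
  also have "?I = {i. i < length (map f xs) \<and> map f xs ! i \<noteq> map g xs ! i}"
    by auto
  finally show ?thesis
    by (simp add: hamming_distance_def)
qed

lemma minimum_distance_evaluation_map:
  fixes ev :: "'p \<Rightarrow> 'v::ab_group_add \<Rightarrow> 'k::ab_group_add"
  assumes "distinct xs"
    and zero: "0 \<in> V" and diff: "\<And>f g. f \<in> V \<Longrightarrow> g \<in> V \<Longrightarrow> f - g \<in> V"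
    and ev_diff: "\<And>x f g. x \<in> set xs \<Longrightarrow> f \<in> V \<Longrightarrow> g \<in> V \<Longrightarrow> ev x (f - g) = ev x f - ev x g"
  defines "supp \<equiv> \<lambda>f. {x \<in> set xs. ev x f \<noteq> 0}"
  shows "minimum_distance ((\<lambda>f. map (\<lambda>x. ev x f) xs) ` V) =
    Inf {enat (card S) | S. S \<subseteq> set xs \<and> (\<exists>f\<in>V. supp f \<noteq> {} \<and> supp f \<subseteq> S)}"
    (is "minimum_distance (?word ` V) = Inf ?W")
proof (rule antisym)
  have supp_diff: "supp (f - g) = {x \<in> set xs. ev x f \<noteq> ev x g}" if "f \<in> V" "g \<in> V" for f g
    using that by (auto simp: supp_def ev_diff)
  have distance: "hamming_distance (?word f) (?word g) = card (supp (f - g))"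
    if "f \<in> V" "g \<in> V" for f g
    using that by (simp add: hamming_distance_map [OF \<open>distinct xs\<close>] supp_diff)
  have word_eq_iff: "?word f = ?word g \<longleftrightarrow> supp (f - g) = {}" if "f \<in> V" "g \<in> V" for f g
    using that by (auto simp: supp_diff)
  show "minimum_distance (?word ` V) \<le> Inf ?W"
  proof (rule Inf_greatest, clarify)
    fix S f assume S: "S \<subseteq> set xs" and f: "f \<in> V" "supp f \<noteq> {}" "supp f \<subseteq> S"
    then have "?word f \<noteq> ?word 0"
      using word_eq_iff [OF f(1) zero] by simp
    then have "minimum_distance (?word ` V) \<le> enat (hamming_distance (?word f) (?word 0))"
      unfolding minimum_distance_def using f(1) zero by (intro Inf_lower) blast
    also have "\<dots> \<le> enat (card S)"
      using S f finite_subset [OF S] by (simp add: distance zero card_mono)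
    finally show "minimum_distance (?word ` V) \<le> enat (card S)" .
  qed
  show "Inf ?W \<le> minimum_distance (?word ` V)"
    unfolding minimum_distance_def
  proof (rule Inf_superset_mono, clarify)
    fix f g assume fg: "f \<in> V" "g \<in> V" "?word f \<noteq> ?word g"
    then have "supp (f - g) \<subseteq> set xs" "supp (f - g) \<noteq> {}"
      using word_eq_iff by (auto simp: supp_def)
    then show "\<exists>S. enat (hamming_distance (?word f) (?word g)) = enat (card S) \<and> S \<subseteq> set xs \<and>
        (\<exists>f\<in>V. supp f \<noteq> {} \<and> supp f \<subseteq> S)"
      using fg distance diff by blast
  qed
qed

definition reduced_divisor :: "'a point set \<Rightarrow> 'a divisor" where
  "reduced_divisor S = (\<Sum>P\<in>S. Poly_Mapping.single P 1)"

lemma reduced_divisor_empty [simp]: "reduced_divisor {} = 0"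
  by (simp add: reduced_divisor_def)

lemma points_divisor_eq_reduced_divisor:
  "distinct Ps \<Longrightarrow> points_divisor Ps = reduced_divisor (set Ps)"
  by (simp add: points_divisor_def reduced_divisor_def sum_list_distinct_conv_sum_set)

lemma lookup_reduced_divisor:
  "finite S \<Longrightarrow> Poly_Mapping.lookup (reduced_divisor S) P = of_bool (P \<in> S)"
  by (simp add: reduced_divisor_def lookup_sum lookup_single when_def of_bool_def)

lemma keys_reduced_divisor: "finite S \<Longrightarrow> Poly_Mapping.keys (reduced_divisor S) = S"
  by (auto simp: in_keys_iff lookup_reduced_divisor)

lemma divisor_le_reduced_divisor_iff:
  assumes "finite S"
  shows "divisor_le 0 A \<and> divisor_le A (reduced_divisor S) \<longleftrightarrow> (\<exists>T\<subseteq>S. A = reduced_divisor T)"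
proof
  assume A: "divisor_le 0 A \<and> divisor_le A (reduced_divisor S)"
  define T where "T = {P \<in> S. Poly_Mapping.lookup A P = 1}"
  have "Poly_Mapping.lookup A P = of_bool (P \<in> T)" for P
    using A [unfolded divisor_le_def, THEN conjunct1, THEN spec, of P]
      A [unfolded divisor_le_def, THEN conjunct2, THEN spec, of P] assms
    by (auto simp: T_def lookup_reduced_divisor of_bool_def split: if_splits)
  then have "A = reduced_divisor T"
    using assms by (intro poly_mapping_eqI) (simp add: lookup_reduced_divisor T_def)
  moreover have "T \<subseteq> S"
    by (auto simp: T_def)
  ultimately show "\<exists>T\<subseteq>S. A = reduced_divisor T"
    by blast
next
  assume "\<exists>T\<subseteq>S. A = reduced_divisor T"
  then show "divisor_le 0 A \<and> divisor_le A (reduced_divisor S)"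
    using assms by (auto simp: divisor_le_def lookup_reduced_divisor finite_subset)
qed

definition least_jump_degree ::
    "('k::field \<Rightarrow> 'a::field) \<Rightarrow> 'a divisor \<Rightarrow> 'a divisor \<Rightarrow> enat" where
  "least_jump_degree emb D C = Inf {enat (nat (divisor_degree emb A)) | A.
     is_divisor emb A \<and> divisor_le 0 A \<and> divisor_le A D \<and>
     riemann_roch_space emb (A - C) \<noteq> riemann_roch_space emb (- C)}"

definition twisted_evaluation_code ::
    "('k::field \<Rightarrow> 'a::field) \<Rightarrow> 'a point list \<Rightarrow> ('a point \<Rightarrow> 'a) \<Rightarrow> 'a divisor \<Rightarrow> 'k list set" where
  "twisted_evaluation_code emb Ps h E =
     (\<lambda>f. map (\<lambda>P. value_at emb P (f * h P)) Ps) ` riemann_roch_space emb E"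

context curve_function_field
begin

lemma divisor_degree_reduced_divisor:
  assumes "finite S" "S \<subseteq> rational_points emb"
  shows "divisor_degree emb (reduced_divisor S) = int (card S)"
proof -
  have "point_degree emb P = 1" if "P \<in> S" for P
    using that assms point_degree_rational by blast
  then show ?thesis
    using assms by (simp add: divisor_degree_def keys_reduced_divisor lookup_reduced_divisor)
qed

lemma least_jump_degree_reduced_divisor:
  assumes S: "finite S" "S \<subseteq> rational_points emb"
  shows "least_jump_degree emb (reduced_divisor S) C =
    Inf {enat (card T) | T. T \<subseteq> S \<and>
      riemann_roch_space emb (reduced_divisor T - C) \<noteq> riemann_roch_space emb (- C)}"
proof -
  have "is_divisor emb (reduced_divisor T)" "nat (divisor_degree emb (reduced_divisor T)) = card T"
    if "T \<subseteq> S" for T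
  proof -
    have T: "finite T" "T \<subseteq> rational_points emb"
      using that S finite_subset by blast+
    then show "is_divisor emb (reduced_divisor T)"
      using rational_point_is_point by (auto simp: is_divisor_def keys_reduced_divisor)
    show "nat (divisor_degree emb (reduced_divisor T)) = card T"
      using T by (simp add: divisor_degree_reduced_divisor)
  qed
  then show ?thesis
    unfolding least_jump_degree_def conj_assoc [of "divisor_le _ _", symmetric]
      divisor_le_reduced_divisor_iff [OF S(1)]
    by (intro arg_cong [where f = Inf]) (auto; metis)
qed

lemma zero_in_riemann_roch_space: "0 \<in> riemann_roch_space emb E"
  by (simp add: riemann_roch_space_iff)

lemma riemann_roch_space_diff:
  "f \<in> riemann_roch_space emb E \<Longrightarrow> g \<in> riemann_roch_space emb E \<Longrightarrow>
     f - g \<in> riemann_roch_space emb E"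
  by (simp add: riemann_roch_space_iff order_ge_diff)

lemma order_ge_riemann_roch_space:
  assumes "f \<in> riemann_roch_space emb (reduced_divisor S - C)" "finite S" "P \<in> points emb"
  shows "order_ge P (Poly_Mapping.lookup C P - of_bool (P \<in> S)) f"
  using assms by (auto simp: riemann_roch_space_iff lookup_minus lookup_reduced_divisor)

lemma riemann_roch_space_reduced_divisor_subset_iff:
  assumes S: "finite S" "S \<subseteq> points emb" and "T \<subseteq> S"
  shows "f \<in> riemann_roch_space emb (reduced_divisor T - C) \<longleftrightarrow>
    f \<in> riemann_roch_space emb (reduced_divisor S - C) \<and>
    (\<forall>P \<in> S - T. order_ge P (Poly_Mapping.lookup C P) f)"
proof -
  have fin_T: "finite T"
    using assms finite_subset by blast
  have "order_ge P (Poly_Mapping.lookup C P - of_bool (P \<in> T)) f \<longleftrightarrow>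
      order_ge P (Poly_Mapping.lookup C P - of_bool (P \<in> S)) f \<and>
      (P \<in> S - T \<longrightarrow> order_ge P (Poly_Mapping.lookup C P) f)" for P
    using \<open>T \<subseteq> S\<close> by (auto simp: of_bool_def elim: order_ge_mono)
  then show ?thesis
    using S(2) by (auto simp: riemann_roch_space_iff lookup_minus lookup_reduced_divisor S(1) fin_T)
qed

text \<open>
  The factor \<open>h P\<close> moves the leading coefficient of \<open>f \<in> L(D - C)\<close> at \<open>P\<close> to the constant term, so
  that both codes are of this shape: \<open>h = 1\<close> for \<open>C\<^sub>L\<close>, and \<open>h P = u t\<close> for
  \<open>C\<^sub>\<Omega>\<close>, where \<open>t\<close> is the uniformizer at \<open>P\<close> and \<open>u dt\<close> a differential with divisor \<open>K\<close>.
\<close>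

lemma minimum_distance_twisted_evaluation_code:
  fixes C :: "'a divisor"
  assumes "distinct Ps" and rational: "set Ps \<subseteq> rational_points emb"
    and h: "\<And>P. P \<in> set Ps \<Longrightarrow> h P \<noteq> 0 \<and> P (h P) = 1 - Poly_Mapping.lookup C P"
  shows "minimum_distance (twisted_evaluation_code emb Ps h (points_divisor Ps - C)) =
    least_jump_degree emb (points_divisor Ps) C"
proof -
  let ?D = "reduced_divisor (set Ps)" and ?ev = "\<lambda>P f. value_at emb P (f * h P)"
  let ?V = "riemann_roch_space emb (?D - C)"
  define supp where "supp f = {P \<in> set Ps. ?ev P f \<noteq> 0}" for f
  have pts: "set Ps \<subseteq> points emb"
    using rational rational_point_is_point by blast
  have order_iff: "order_ge P n (f * h P) \<longleftrightarrow> order_ge P (n - 1 + Poly_Mapping.lookup C P) f"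
    if "P \<in> set Ps" for P n f
    using order_ge_mult_iff [of P "h P"] that pts h [OF that] by (auto simp: algebra_simps)
  have regular: "order_ge P 0 (f * h P)" if "P \<in> set Ps" "f \<in> ?V" for P f
    using order_ge_riemann_roch_space [OF that(2), of P] that(1) pts by (auto simp: order_iff)
  have ev_eq_0_iff: "?ev P f = 0 \<longleftrightarrow> order_ge P (Poly_Mapping.lookup C P) f"
    if "P \<in> set Ps" "f \<in> ?V" for P f
    using that rational regular by (auto simp: value_at_eq_0_iff order_iff)
  have L_iff: "f \<in> riemann_roch_space emb (reduced_divisor T - C) \<longleftrightarrow> f \<in> ?V \<and> supp f \<subseteq> T"
    if "T \<subseteq> set Ps" for T f
    using ev_eq_0_iff riemann_roch_space_reduced_divisor_subset_iff [OF _ pts that]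
    by (auto simp: supp_def)
  have L_0_iff: "f \<in> riemann_roch_space emb (- C) \<longleftrightarrow> f \<in> ?V \<and> supp f = {}" for f
    using L_iff [of "{}" f] by simp
  have L_neq_iff:
    "riemann_roch_space emb (reduced_divisor T - C) \<noteq> riemann_roch_space emb (- C) \<longleftrightarrow>
      (\<exists>f\<in>?V. supp f \<noteq> {} \<and> supp f \<subseteq> T)" if "T \<subseteq> set Ps" for T
    using L_iff [OF that] L_0_iff by blast
  have "minimum_distance (twisted_evaluation_code emb Ps h (?D - C)) =
      Inf {enat (card T) | T. T \<subseteq> set Ps \<and> (\<exists>f\<in>?V. supp f \<noteq> {} \<and> supp f \<subseteq> T)}"
    unfolding twisted_evaluation_code_def supp_def
  proof (rule minimum_distance_evaluation_map)
    show "?ev P (f - g) = ?ev P f - ?ev P g" if "P \<in> set Ps" "f \<in> ?V" "g \<in> ?V" for P f g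
      using that rational regular by (auto simp: left_diff_distrib value_at_diff)
  qed (use \<open>distinct Ps\<close> zero_in_riemann_roch_space riemann_roch_space_diff in auto)
  also have "\<dots> = least_jump_degree emb ?D C"
    by (simp add: least_jump_degree_reduced_divisor [OF finite_set rational] L_neq_iff
        cong: conj_cong)
  finally show ?thesis
    by (simp add: points_divisor_eq_reduced_divisor [OF \<open>distinct Ps\<close>])
qed

lemma minimum_distance_code_L:
  assumes "distinct Ps" and rational: "set Ps \<subseteq> rational_points emb"
    and disjoint: "Poly_Mapping.keys G \<inter> set Ps = {}"
  shows "minimum_distance (code_L emb Ps G) =
    least_jump_degree emb (points_divisor Ps) (points_divisor Ps - G)"
proof -
  have "P 1 = 1 - Poly_Mapping.lookup (points_divisor Ps - G) P" if "P \<in> set Ps" for P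
  proof -
    have "P 1 = 0"
      using that rational rational_point_is_point point_1 by blast
    moreover have "Poly_Mapping.lookup G P = 0"
      using that disjoint by (auto simp: in_keys_iff)
    ultimately show ?thesis
      using that \<open>distinct Ps\<close>
      by (simp add: lookup_minus points_divisor_eq_reduced_divisor lookup_reduced_divisor)
  qed
  then have "minimum_distance (twisted_evaluation_code emb Ps (\<lambda>_. 1)
      (points_divisor Ps - (points_divisor Ps - G))) =
    least_jump_degree emb (points_divisor Ps) (points_divisor Ps - G)"
    using assms by (intro minimum_distance_twisted_evaluation_code) auto
  then show ?thesis
    by (simp add: twisted_evaluation_code_def code_L_def)
qed

end

section \<open>Laurent expansions and residues\<close>

primrec laurent_remainder ::
    "('k::field \<Rightarrow> 'a::field) \<Rightarrow> 'a point \<Rightarrow> 'a \<Rightarrow> int \<Rightarrow> 'a \<Rightarrow> nat \<Rightarrow> 'a" where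
  "laurent_remainder emb P t m f 0 = f"
| "laurent_remainder emb P t m f (Suc n) =
     (let r = laurent_remainder emb P t m f n; i = m + int n in
      r - emb (value_at emb P (r * t powi (- i))) * t powi i)"

definition laurent_coefficient ::
    "('k::field \<Rightarrow> 'a::field) \<Rightarrow> 'a point \<Rightarrow> 'a \<Rightarrow> int \<Rightarrow> 'a \<Rightarrow> int \<Rightarrow> 'k" where
  "laurent_coefficient emb P t m f i = (if i < m then 0
     else value_at emb P (laurent_remainder emb P t m f (nat (i - m)) * t powi (- i)))"

context curve_function_field
begin

context
  fixes P t
  assumes P: "P \<in> points emb" and t: "t \<noteq> 0" "P t = 1"
begin

lemma order_ge_mult_powi_iff: "order_ge P n (f * t powi i) \<longleftrightarrow> order_ge P (n - i) f"
  using t by (simp add: order_ge_mult_iff [OF P] point_powi [OF P])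

lemma order_ge_emb_powi: "n \<le> i \<Longrightarrow> order_ge P n (emb c * t powi i)"
  using t by (intro order_ge_emb_mult [OF P]) (simp add: order_ge_def point_powi [OF P])

lemma laurent_expansion_iff:
  "laurent_expansion emb P t f c \<longleftrightarrow>
     (\<exists>m. (\<forall>i<m. c i = 0) \<and>
       (\<forall>N\<ge>m. order_ge P (N + 1) (f - (\<Sum>i=m..N. emb (c i) * t powi i))))"
  by (simp add: laurent_expansion_def order_ge_def Let_def less_iff_succ_less_eq)

lemma laurent_expansion_lower_bound:
  assumes "laurent_expansion emb P t f c"
  obtains m where "\<And>i. i < m \<Longrightarrow> c i = 0"
    "\<And>l N. l \<le> m \<Longrightarrow> order_ge P (N + 1) (f - (\<Sum>i=l..N. emb (c i) * t powi i))"
proof -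
  obtain m where m: "\<forall>i<m. c i = 0"
    and exp: "\<And>N. N \<ge> m \<Longrightarrow> order_ge P (N + 1) (f - (\<Sum>i=m..N. emb (c i) * t powi i))"
    using assms unfolding laurent_expansion_iff by blast
  have "order_ge P (N + 1) (f - (\<Sum>i=l..N. emb (c i) * t powi i))" if "l \<le> m" for l N
  proof (cases "m \<le> N")
    case True
    have "(\<Sum>i=l..N. emb (c i) * t powi i) = (\<Sum>i=m..N. emb (c i) * t powi i)"
      using m \<open>l \<le> m\<close> by (intro sum.mono_neutral_right) (auto simp: emb.zero)
    with exp True show ?thesis
      by simp
  next
    case False
    have "order_ge P m (f - emb (c m) * t powi m)"
      using exp [of m] by (auto intro: order_ge_mono)
    from order_ge_add [OF P this order_ge_emb_powi [of m m "c m"]] have "order_ge P m f"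
      by simp
    moreover have "(\<Sum>i=l..N. emb (c i) * t powi i) = 0"
      using m False by (intro sum.neutral) (auto simp: emb.zero)
    ultimately show ?thesis
      using False by (auto intro: order_ge_mono)
  qed
  with m that show thesis
    by blast
qed

lemma laurent_expansion_diff:
  assumes "laurent_expansion emb P t f c" "laurent_expansion emb P t g d"
  shows "laurent_expansion emb P t (f - g) (\<lambda>i. c i - d i)"
proof -
  obtain m where m: "\<And>i. i < m \<Longrightarrow> c i = 0"
    "\<And>l N. l \<le> m \<Longrightarrow> order_ge P (N + 1) (f - (\<Sum>i=l..N. emb (c i) * t powi i))"
    by (rule laurent_expansion_lower_bound [OF assms(1)]) blast
  obtain n where n: "\<And>i. i < n \<Longrightarrow> d i = 0"
    "\<And>l N. l \<le> n \<Longrightarrow> order_ge P (N + 1) (g - (\<Sum>i=l..N. emb (d i) * t powi i))"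
    by (rule laurent_expansion_lower_bound [OF assms(2)]) blast
  have "order_ge P (N + 1) (f - g - (\<Sum>i=min m n..N. emb (c i - d i) * t powi i))" for N
    using order_ge_diff [OF P m(2) n(2), of "min m n" "min m n" N]
    by (simp add: emb.diff left_diff_distrib sum_subtractf algebra_simps)
  then show ?thesis
    unfolding laurent_expansion_iff using m(1) n(1) by (intro exI [of _ "min m n"]) auto
qed

lemma laurent_expansion_zero:
  assumes "laurent_expansion emb P t 0 c"
  shows "c i = 0"
proof -
  obtain m where m: "\<And>i. i < m \<Longrightarrow> c i = 0"
    and exp: "\<And>l N. l \<le> m \<Longrightarrow> order_ge P (N + 1) (0 - (\<Sum>i=l..N. emb (c i) * t powi i))"
    by (rule laurent_expansion_lower_bound [OF assms]) blast
  have nonneg: "c (m + int j) = 0" for j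
  proof (induction j rule: less_induct)
    case (less j)
    have "c l = 0" if "l < m + int j" for l
      using less.IH [of "nat (l - m)"] m [of l] that by (cases "l < m") (auto simp: nat_less_iff)
    then have "(\<Sum>l=m..m + int j. emb (c l) * t powi l) = (\<Sum>l\<in>{m + int j}. emb (c l) * t powi l)"
      by (intro sum.mono_neutral_right) (auto simp: emb.zero)
    with exp [of m "m + int j"]
    have "order_ge P (m + int j + 1) (emb (c (m + int j)) * t powi (m + int j))"
      by (simp add: order_ge_minus [OF P])
    then show ?case
      by (simp add: order_ge_mult_powi_iff order_ge_emb_pos [OF P])
  qed
  then show ?thesis
    using m [of i] nonneg [of "nat (i - m)"] by (cases "i < m") auto
qed

lemma laurent_expansion_unique:
  assumes "laurent_expansion emb P t f c" "laurent_expansion emb P t f d"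
  shows "c = d"
  using laurent_expansion_zero laurent_expansion_diff [OF assms] by fastforce

end

context
  fixes P t
  assumes rational: "P \<in> rational_points emb" and t: "t \<noteq> 0" "P t = 1"
begin

private lemmas expansion_point = rational_point_is_point [OF rational]

lemma order_ge_laurent_remainder:
  assumes "order_ge P m f"
  shows "order_ge P (m + int n) (laurent_remainder emb P t m f n)"
proof (induction n)
  case 0
  then show ?case
    using assms by simp
next
  case (Suc n)
  let ?r = "laurent_remainder emb P t m f" and ?i = "m + int n"
  let ?c = "value_at emb P (?r n * t powi (- ?i))"
  have "order_ge P 0 (?r n * t powi (- ?i))"
    using Suc by (simp add: order_ge_mult_powi_iff [OF expansion_point t] add.commute)
  then have "order_ge P 1 (?r n * t powi (- ?i) - emb ?c)"
    by (rule value_at [OF rational])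
  also have "?r n * t powi (- ?i) - emb ?c = ?r (Suc n) * t powi (- ?i)"
    using t by (simp add: Let_def left_diff_distrib mult.assoc flip: power_int_add)
  finally show ?case
    unfolding order_ge_mult_powi_iff [OF expansion_point t]
    by (simp add: algebra_simps del: laurent_remainder.simps)
qed

lemma laurent_remainder_eq:
  "laurent_remainder emb P t m f (Suc n) =
     f - (\<Sum>i=m..m + int n. emb (laurent_coefficient emb P t m f i) * t powi i)"
proof (induction n)
  case 0
  show ?case
    by (simp add: laurent_coefficient_def)
next
  case (Suc n)
  have "{m..m + int (Suc n)} = insert (m + int (Suc n)) {m..m + int n}"
    by auto
  then show ?case
    using Suc by (simp add: Let_def laurent_coefficient_def nat_add_distrib algebra_simps
        del: laurent_remainder.simps add: laurent_remainder.simps(2) [of _ _ _ _ _ "Suc n"])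
qed

lemma laurent_expansion_laurent_coefficient:
  assumes "order_ge P m f"
  shows "laurent_expansion emb P t f (laurent_coefficient emb P t m f)"
  unfolding laurent_expansion_iff [OF expansion_point t]
proof (intro exI [of _ m] conjI allI impI)
  fix N assume "m \<le> N"
  then show "order_ge P (N + 1)
      (f - (\<Sum>i=m..N. emb (laurent_coefficient emb P t m f i) * t powi i))"
    using order_ge_laurent_remainder [OF assms, of "Suc (nat (N - m))"]
      laurent_remainder_eq [of m f "nat (N - m)"]
    by (simp del: laurent_remainder.simps add: algebra_simps)
qed (simp add: laurent_coefficient_def)

end

lemma residue_at_simple_pole:
  assumes rational: "P \<in> rational_points emb"
    and pole: "order_ge P (- 1) (local_coefficient emb P \<omega>)"
  shows "residue_at emb P \<omega> = value_at emb P (local_coefficient emb P \<omega> * uniformizer P)"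
proof -
  note P = rational_point_is_point [OF rational]
  note t = uniformizer [OF P]
  let ?u = "local_coefficient emb P \<omega>" and ?t = "uniformizer P"
  have "laurent_expansion emb P ?t ?u (laurent_coefficient emb P ?t (- 1) ?u)"
    by (rule laurent_expansion_laurent_coefficient [OF rational t pole])
  then have "(THE c. laurent_expansion emb P ?t ?u c) = laurent_coefficient emb P ?t (- 1) ?u"
    using laurent_expansion_unique [OF P t] by blast
  then show ?thesis
    by (simp add: residue_at_def laurent_coefficient_def)
qed

end

section \<open>Separating elements\<close>

lemma (in curve_function_field) ex_finite_extension_of_fract_poly:
  "\<exists>(h :: 'k poly fract \<Rightarrow> 'a) B. field_hom h \<and> finite B \<and> module.span (\<lambda>r a. h r * a) B = UNIV"
proof -
  obtain x B where x: "\<not> algebraic_over emb x" and B: "finite B"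
    "\<And>f. \<exists>c. (\<forall>b\<in>B. c b \<in> rational_functions_in emb x) \<and> f = (\<Sum>b\<in>B. c b * b)"
    using one_variable by blast
  let ?ev = "\<lambda>f. poly (map_poly emb f) x"
  interpret ev: idom_embedding ?ev
    using emb.comm_ring_hom_poly_map_poly x
    by (auto simp: idom_embedding_def idom_embedding_axioms_def algebraic_over_def)
  define h where "h = fract_extension ?ev"
  interpret h: field_hom h
    unfolding h_def by (rule ev.field_hom_fract_extension)
  have in_range: "r \<in> range h" if r: "r \<in> rational_functions_in emb x" for r
  proof -
    obtain f g where fg: "r = ?ev f / ?ev g" "?ev g \<noteq> 0"
      using r unfolding rational_functions_in_def by blast
    then have "r = h (Fract f g)"
      unfolding h_def by (subst ev.fract_extension_Fract) auto
    then show ?thesis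
      by blast
  qed
  have "f \<in> h.extension.span B" for f
  proof -
    obtain c where c: "\<forall>b\<in>B. c b \<in> range h" "f = (\<Sum>b\<in>B. c b * b)"
      using B(2) [of f] in_range by blast
    have "c b * b \<in> h.extension.span B" if "b \<in> B" for b
      using c(1) that h.extension.span_scale [OF h.extension.span_base [OF that]] by auto
    then show ?thesis
      unfolding c(2) by (rule h.extension.span_sum)
  qed
  then show ?thesis
    using h.field_hom_axioms B(1) by blast
qed

locale perfect_curve_function_field = curve_function_field emb
  for emb :: "'k::field \<Rightarrow> 'a::field" +
  fixes p :: nat
  assumes p_def: "p = CHAR('k)"
    and prime_p: "prime p"
    and perfect: "surj (\<lambda>c :: 'k. c ^ p)"
begin

lemma CHAR_eq_p: "CHAR('k) = p" "CHAR('a) = p"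
  by (simp_all add: p_def emb.CHAR_eq)

lemma of_nat_p: "of_nat p = (0 :: 'a)"
  using of_nat_CHAR [where 'a = 'a] by (simp add: CHAR_eq_p)

lemma p_pos: "p > 0"
  using prime_p prime_gt_0_nat by blast

sublocale frobenius: field_hom "\<lambda>x :: 'a. x ^ p"
  using field_hom_frobenius [where 'a = 'a] prime_p by (simp add: CHAR_eq_p)

lemma ex_emb_eq_power_p: "\<exists>d. emb c = emb d ^ p"
proof -
  obtain d where "c = d ^ p"
    using perfect by blast
  then show ?thesis
    by (auto simp: emb.power)
qed

lemma independent_over_frobenius:
  assumes "frobenius.extension.independent T"
  shows "finite T \<and> card T \<le> p"
proof -
  obtain h :: "'k poly fract \<Rightarrow> 'a" and B where h: "field_hom h"
    and B: "finite B" "module.span (\<lambda>r a. h r * a) B = UNIV"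
    using ex_finite_extension_of_fract_poly by blast
  interpret h: field_hom h by (rule h)
  have CHAR: "CHAR('k poly fract) = p"
    using CHAR_eq_p(2) by (simp add: h.CHAR_eq)
  let ?S = "(\<lambda>i. (Fract [:0, 1:] 1 :: 'k poly fract) ^ i) ` {..<p}"
  have T: "finite T \<and> card T \<le> card ?S"
  proof (rule independent_card_le_of_commuting_homs [OF h _ frobenius.field_hom_axioms])
    show "field_hom (\<lambda>r :: 'k poly fract. r ^ p)"
      using field_hom_frobenius [where 'a = "'k poly fract"] prime_p by (simp add: CHAR)
    show "module.span (\<lambda>r a. r ^ p * a) ?S = (UNIV :: 'k poly fract set)"
      using span_powers_fract_poly [where 'k = 'k] prime_p perfect by (simp add: CHAR_eq_p)
  qed (use B assms h.power in simp_all)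
  have "card ?S \<le> p"
    using card_image_le [of "{..<p}"] by simp
  with T show ?thesis
    by simp
qed

definition p_basis :: "'a \<Rightarrow> bool" where
  "p_basis t \<longleftrightarrow> inj_on (\<lambda>i. t ^ i) {..<p} \<and>
     frobenius.extension.independent ((\<lambda>i. t ^ i) ` {..<p}) \<and>
     frobenius.extension.span ((\<lambda>i. t ^ i) ` {..<p}) = UNIV"

text \<open>The nonzero terms of an \<open>F ^ p\<close>-linear combination have distinct orders modulo \<open>p\<close>.\<close>

lemma powers_independent_over_frobenius:
  assumes P: "P \<in> points emb" and t: "t \<noteq> 0" "\<not> int p dvd P t"
  shows "inj_on (\<lambda>i. t ^ i) {..<p}" and "frobenius.extension.independent ((\<lambda>i. t ^ i) ` {..<p})"
proof -
  have "u i = 0" if sum_0: "(\<Sum>i<p. u i ^ p * t ^ i) = 0" and "i < p" for u i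
  proof (rule ccontr)
    assume "u i \<noteq> 0"
    define I where "I = {i. i < p \<and> u i \<noteq> 0}"
    have order: "P (u i ^ p * t ^ i) = int p * P (u i) + int i * P t" if "i \<in> I" for i
      using that t by (simp add: I_def point_mult [OF P] point_power [OF P])
    have "inj_on (\<lambda>i. P (u i ^ p * t ^ i)) I"
    proof (rule inj_onI)
      fix i j assume ij: "i \<in> I" "j \<in> I" "P (u i ^ p * t ^ i) = P (u j ^ p * t ^ j)"
      then have "int p * P (u i) + int i * P t = int p * P (u j) + int j * P t"
        by (simp only: order)
      then have "(int i - int j) * P t = int p * (P (u j) - P (u i))"
        by (simp add: algebra_simps)
      then have "int p dvd int i - int j"
        using t(2) prime_p prime_dvd_mult_iff [of "int p" "int i - int j" "P t"] by simp
      then show "i = j"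
        using ij(1,2) by (simp add: I_def flip: mod_eq_dvd_iff)
    qed
    then have "(\<Sum>i\<in>I. u i ^ p * t ^ i) \<noteq> 0"
      using \<open>u i \<noteq> 0\<close> \<open>i < p\<close> t by (intro sum_nonzero_of_distinct_orders [OF P]) (auto simp: I_def)
    also have "(\<Sum>i\<in>I. u i ^ p * t ^ i) = (\<Sum>i<p. u i ^ p * t ^ i)"
      using p_pos by (intro sum.mono_neutral_left) (auto simp: I_def)
    finally show False
      using sum_0 by contradiction
  qed
  then show "inj_on (\<lambda>i. t ^ i) {..<p}"
    and "frobenius.extension.independent ((\<lambda>i. t ^ i) ` {..<p})"
    using frobenius.extension.independent_family [of "{..<p}" "\<lambda>i. t ^ i"] by auto
qed

lemma p_basis_of_order:
  assumes "P \<in> points emb" "t \<noteq> 0" "\<not> int p dvd P t"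
  shows "p_basis t"
proof -
  let ?T = "(\<lambda>i. t ^ i) ` {..<p}"
  note inj = powers_independent_over_frobenius(1) [OF assms]
    and indep = powers_independent_over_frobenius(2) [OF assms]
  have "z \<in> frobenius.extension.span ?T" for z
  proof (rule ccontr)
    assume z: "z \<notin> frobenius.extension.span ?T"
    have "card (insert z ?T) \<le> p"
      using independent_over_frobenius [OF frobenius.extension.independent_insertI [OF z indep]]
      by (rule conjunct2)
    moreover have "z \<notin> ?T"
      by (rule contra_subsetD [OF frobenius.extension.span_superset z])
    ultimately show False
      by (simp add: card_image [OF inj])
  qed
  with inj indep show ?thesis
    by (auto simp: p_basis_def)
qed

lemma p_basis_uniformizer:
  assumes "P \<in> points emb"
  shows "p_basis (uniformizer P)"
  using uniformizer [OF assms] prime_p by (intro p_basis_of_order [OF assms]) auto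

end

section \<open>Derivations\<close>

locale derivation_over = additive D for emb :: "'k::field \<Rightarrow> 'a::field" and D :: "'a \<Rightarrow> 'a" +
  assumes leibniz: "D (x * y) = x * D y + y * D x"
    and const: "D (emb c) = 0"
begin

lemma one: "D 1 = 0"
  using leibniz [of 1 1] by (simp only: mult_1 add_cancel_right_right)

lemma power: "D (x ^ n) = of_nat n * x ^ (n - 1) * D x"
proof (induction n)
  case (Suc n)
  then show ?case
    by (cases n) (simp_all add: leibniz one algebra_simps)
qed (simp add: one)

end

context perfect_curve_function_field
begin

lemma ex_linear_power_rule:
  assumes "p_basis t"
  obtains D where "Vector_Spaces.linear (\<lambda>a z. a ^ p * z) (\<lambda>a z. a ^ p * z) D"
    and "\<And>n. D (t ^ n) = of_nat n * t ^ (n - 1)"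
proof -
  interpret pair: vector_space_pair "\<lambda>a z :: 'a. a ^ p * z" "\<lambda>a z :: 'a. a ^ p * z" ..
  have inj: "inj_on (\<lambda>i. t ^ i) {..<p}"
    and indep: "frobenius.extension.independent ((\<lambda>i. t ^ i) ` {..<p})"
    using assms by (auto simp: p_basis_def)
  define exponent where "exponent = the_inv_into {..<p} (\<lambda>i. t ^ i)"
  obtain D where D: "Vector_Spaces.linear (\<lambda>a z. a ^ p * z) (\<lambda>a z. a ^ p * z) D"
    and D_powers: "\<And>x. x \<in> (\<lambda>i. t ^ i) ` {..<p} \<Longrightarrow> D x = of_nat (exponent x) * t ^ (exponent x - 1)"
    using pair.linear_independent_extend [OF indep,
        of "\<lambda>x. of_nat (exponent x) * t ^ (exponent x - 1)"] by blast
  interpret D: Vector_Spaces.linear "\<lambda>a z. a ^ p * z" "\<lambda>a z. a ^ p * z" D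
    by (rule D)
  have D_small: "D (t ^ i) = of_nat i * t ^ (i - 1)" if "i < p" for i
    using that D_powers [of "t ^ i"] by (simp add: exponent_def the_inv_into_f_f [OF inj])
  have "D (t ^ n) = of_nat n * t ^ (n - 1)" for n
  proof -
    define q r where "q = n div p" and "r = n mod p"
    have n: "n = q * p + r"
      by (simp add: q_def r_def)
    have "D (t ^ n) = (t ^ q) ^ p * D (t ^ r)"
      using D.scale [of "t ^ q" "t ^ r"] by (simp add: n power_add power_mult)
    also have "\<dots> = of_nat r * t ^ (q * p + (r - 1))"
      using D_small [of r] p_pos by (simp add: r_def power_add power_mult)
    also have "\<dots> = of_nat n * t ^ (n - 1)"
      by (cases r) (simp_all add: n of_nat_p)
    finally show ?thesis .
  qed
  with D show thesis
    by (rule that)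
qed

lemma leibniz_of_power_rule:
  assumes t: "p_basis t"
    and D: "Vector_Spaces.linear (\<lambda>a z. a ^ p * z) (\<lambda>a z. a ^ p * z) D"
    and D_power: "\<And>n. D (t ^ n) = of_nat n * t ^ (n - 1)"
  shows "D (x * y) = x * D y + y * D x"
proof -
  interpret D: Vector_Spaces.linear "\<lambda>a z. a ^ p * z" "\<lambda>a z. a ^ p * z" D
    by (rule D)
  have span_t: "z \<in> frobenius.extension.span ((\<lambda>i. t ^ i) ` {..<p})" for z
    using t by (simp add: p_basis_def)
  have subspace: "frobenius.extension.subspace {x. D (x * y) = x * D y + y * D x}" for y
    by (rule frobenius.extension.subspaceI)
      (simp_all add: D.zero D.add D.scale mult.assoc distrib_left distrib_right
        mult.left_commute [of y])
  have powers: "D (t ^ i * t ^ j) = t ^ i * D (t ^ j) + t ^ j * D (t ^ i)" for i j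
  proof -
    have "D (t ^ i * t ^ j) = D (t ^ (i + j))"
      by (simp add: power_add)
    also have "\<dots> = t ^ i * D (t ^ j) + t ^ j * D (t ^ i)"
      unfolding D_power by (cases i; cases j) (simp_all add: power_add algebra_simps)
    finally show ?thesis .
  qed
  have "D (y * t ^ j) = y * D (t ^ j) + t ^ j * D y" for j
    using span_t [of y] by (rule frobenius.extension.span_induct) (use subspace powers in auto)
  then have power_left: "D (t ^ j * y) = t ^ j * D y + y * D (t ^ j)" for j
    by (simp only: mult.commute [of "t ^ j" y] add.commute)
  show ?thesis
    using span_t [of x] by (rule frobenius.extension.span_induct) (use subspace power_left in auto)
qed

lemma ex_derivation:
  assumes t: "p_basis t"
  shows "\<exists>D. derivation_over emb D \<and> D t = 1"
proof -
  obtain D where D: "Vector_Spaces.linear (\<lambda>a z. a ^ p * z) (\<lambda>a z. a ^ p * z) D"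
    and D_power: "\<And>n. D (t ^ n) = of_nat n * t ^ (n - 1)"
    using ex_linear_power_rule [OF t] by blast
  interpret D: Vector_Spaces.linear "\<lambda>a z. a ^ p * z" "\<lambda>a z. a ^ p * z" D
    by (rule D)
  have const: "D (emb c) = 0" for c
  proof -
    obtain d where "emb c = emb d ^ p * t ^ 0"
      using ex_emb_eq_power_p [of c] by auto
    then show ?thesis
      using D_power [of 0] by (simp only: D.scale) simp
  qed
  have "derivation_over emb D"
    by unfold_locales (fact D.add leibniz_of_power_rule [OF t D D_power] const)+
  then show ?thesis
    using D_power [of 1] by auto
qed

end

section \<open>Kaehler differentials\<close>

interpretation kaehler: module "\<lambda>a :: 'a::field. Poly_Mapping.map ((*) a) :: ('b \<Rightarrow>\<^sub>0 'a) \<Rightarrow> _"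
  by (rule module_poly_mapping)

text \<open>For a derivation \<open>D\<close> this is the linear map on Kaehler differentials with \<open>dz \<mapsto> D z\<close>.\<close>

definition kaehler_functional :: "('a \<Rightarrow> 'a) \<Rightarrow> ('a \<Rightarrow>\<^sub>0 'a) \<Rightarrow> 'a::field" where
  "kaehler_functional D w = (\<Sum>z\<in>Poly_Mapping.keys w. Poly_Mapping.lookup w z * D z)"

lemma kaehler_functional_superset:
  assumes "finite S" "Poly_Mapping.keys w \<subseteq> S"
  shows "kaehler_functional D w = (\<Sum>z\<in>S. Poly_Mapping.lookup w z * D z)"
  unfolding kaehler_functional_def using assms
  by (intro sum.mono_neutral_left) (auto simp: in_keys_iff)

lemma kaehler_functional_single [simp]: "kaehler_functional D (Poly_Mapping.single z u) = u * D z"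
  by (simp add: kaehler_functional_def)

lemma module_hom_kaehler_functional:
  "module_hom (\<lambda>a. Poly_Mapping.map ((*) a)) (*) (kaehler_functional D)"
proof -
  have "kaehler_functional D (v + w) = kaehler_functional D v + kaehler_functional D w" for v w
    using Poly_Mapping.keys_add [of v w]
    by (simp add: kaehler_functional_superset [of "Poly_Mapping.keys v \<union> Poly_Mapping.keys w"]
        lookup_add distrib_right sum.distrib)
  moreover have "kaehler_functional D (Poly_Mapping.map ((*) a) w) = a * kaehler_functional D w"
    for a w
  proof -
    have lookup:
      "Poly_Mapping.lookup (Poly_Mapping.map ((*) a) w) z = a * Poly_Mapping.lookup w z" for z
      by (simp add: map.rep_eq when_def)
    then have "Poly_Mapping.keys (Poly_Mapping.map ((*) a) w) \<subseteq> Poly_Mapping.keys w"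
      by (auto simp: in_keys_iff)
    then show ?thesis
      by (simp add: kaehler_functional_superset [of "Poly_Mapping.keys w"] lookup sum_distrib_left
          mult.assoc)
  qed
  ultimately show ?thesis
    by (simp add: module_hom_iff module_poly_mapping module_def algebra_simps)
qed

lemmas kaehler_functional_diff = module_hom.diff [OF module_hom_kaehler_functional]
  and kaehler_functional_scale = module_hom.scale [OF module_hom_kaehler_functional]

lemma (in derivation_over) kaehler_functional_relation:
  assumes "w \<in> kaehler_relations emb"
  shows "kaehler_functional D w = 0"
  using assms unfolding kaehler_relations_def
  by (rule module_hom.eq_0_on_span [OF module_hom_kaehler_functional, rotated])
    (auto simp: kaehler_functional_diff add leibniz const)

lemma kaehler_relations_diff:
  "v \<in> kaehler_relations emb \<Longrightarrow> w \<in> kaehler_relations emb \<Longrightarrow> v - w \<in> kaehler_relations emb"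
  unfolding kaehler_relations_def by (rule kaehler.span_diff)

lemma kaehler_relations_add:
  "v \<in> kaehler_relations emb \<Longrightarrow> w \<in> kaehler_relations emb \<Longrightarrow> v + w \<in> kaehler_relations emb"
  unfolding kaehler_relations_def by (rule kaehler.span_add)

lemma kaehler_relations_scale:
  "w \<in> kaehler_relations emb \<Longrightarrow> Poly_Mapping.map ((*) a) w \<in> kaehler_relations emb"
  unfolding kaehler_relations_def by (rule kaehler.span_scale)

lemma zero_in_kaehler_relations: "0 \<in> kaehler_relations emb"
  unfolding kaehler_relations_def by (rule kaehler.span_zero)

lemma kaehler_relation_add:
  "Poly_Mapping.single (x + y) 1 - Poly_Mapping.single x 1 - Poly_Mapping.single y 1
     \<in> kaehler_relations emb"
  unfolding kaehler_relations_def by (rule kaehler.span_base) blast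

lemma kaehler_relation_mult:
  "Poly_Mapping.single (x * y) 1 - Poly_Mapping.single y x - Poly_Mapping.single x y
     \<in> kaehler_relations emb"
  unfolding kaehler_relations_def by (rule kaehler.span_base) blast

lemma kaehler_relation_emb: "Poly_Mapping.single (emb c) 1 \<in> kaehler_relations emb"
  unfolding kaehler_relations_def by (rule kaehler.span_base) blast

lemma kaehler_class_eq_iff:
  "kaehler_class emb v = kaehler_class emb w \<longleftrightarrow> v - w \<in> kaehler_relations emb"
proof
  have "v \<in> kaehler_class emb v"
    by (simp add: kaehler_class_def zero_in_kaehler_relations)
  moreover assume "kaehler_class emb v = kaehler_class emb w"
  ultimately have "v \<in> kaehler_class emb w"
    by simp
  then show "v - w \<in> kaehler_relations emb"
    by (simp add: kaehler_class_def)
next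
  assume "v - w \<in> kaehler_relations emb"
  then have "u - v \<in> kaehler_relations emb \<longleftrightarrow> u - w \<in> kaehler_relations emb" for u
    using kaehler_relations_add [of "u - v" emb "v - w"]
      kaehler_relations_diff [of "u - w" emb "v - w"]
    by auto
  then show "kaehler_class emb v = kaehler_class emb w"
    by (auto simp: kaehler_class_def)
qed

lemma (in curve_function_field) kaehler_relation_power:
  "Poly_Mapping.single (x ^ n) 1 - Poly_Mapping.single x (of_nat n * x ^ (n - 1))
     \<in> kaehler_relations emb"
proof (induction n)
  case 0
  show ?case
    using kaehler_relation_emb [of emb 1] by (simp add: emb_one)
next
  case (Suc n)
  have shift: "x * (of_nat n * x ^ (n - Suc 0)) = of_nat n * x ^ n"
    by (cases n) (simp_all add: algebra_simps)
  have "Poly_Mapping.single (x ^ n) x - Poly_Mapping.single x (of_nat n * x ^ n)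
      \<in> kaehler_relations emb"
    using kaehler_relations_scale [OF Suc, of x]
    by (simp add: kaehler.scale_right_diff_distrib shift)
  from kaehler_relations_add [OF kaehler_relation_mult [of x "x ^ n"] this] show ?case
    by (simp add: single_add algebra_simps)
qed

context perfect_curve_function_field
begin

lemma kaehler_relation_frobenius_scale:
  assumes "Poly_Mapping.single z 1 - Poly_Mapping.single t y \<in> kaehler_relations emb"
  shows "Poly_Mapping.single (a ^ p * z) 1 - Poly_Mapping.single t (a ^ p * y)
    \<in> kaehler_relations emb"
proof -
  have "Poly_Mapping.single (a ^ p) 1 \<in> kaehler_relations emb"
    using kaehler_relation_power [of a p] by (simp add: of_nat_p)
  from kaehler_relations_scale [OF this, of z]
  have "Poly_Mapping.single (a ^ p) z \<in> kaehler_relations emb"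
    by simp
  moreover have "Poly_Mapping.single z (a ^ p) - Poly_Mapping.single t (a ^ p * y)
      \<in> kaehler_relations emb"
    using kaehler_relations_scale [OF assms, of "a ^ p"]
    by (simp add: kaehler.scale_right_diff_distrib)
  ultimately show ?thesis
    using kaehler_relations_add [OF kaehler_relations_add [OF kaehler_relation_mult [of "a ^ p" z]]]
    by fastforce
qed

text \<open>\<open>dz = (D z) dt\<close>, since both sides are \<open>F ^ p\<close>-linear in \<open>z\<close> and agree on the powers of \<open>t\<close>.\<close>

lemma kaehler_relation_derivation:
  assumes t: "p_basis t" and D: "derivation_over emb D" "D t = 1"
  shows "Poly_Mapping.single z 1 - Poly_Mapping.single t (D z) \<in> kaehler_relations emb"
    (is "?R z")
proof -
  interpret D: derivation_over emb D by (rule D)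
  have D_frobenius: "D (a ^ p * y) = a ^ p * D y" for a y
    by (simp add: D.leibniz D.power of_nat_p)
  have R_add: "?R (x + y)" if "?R x" "?R y" for x y
  proof -
    note kaehler_relations_add [OF kaehler_relation_add [of x y] \<open>?R x\<close>]
    from kaehler_relations_add [OF this \<open>?R y\<close>] show ?thesis
      by (simp add: D.add single_add algebra_simps)
  qed
  have "frobenius.extension.subspace {z. ?R z}"
    using R_add kaehler_relation_frobenius_scale kaehler_relation_emb [of emb 0]
    by (intro frobenius.extension.subspaceI) (auto simp: D_frobenius D.zero emb.zero)
  moreover have "?R (t ^ i)" for i
    using kaehler_relation_power [of t i] by (simp add: D.power D(2))
  moreover have "z \<in> frobenius.extension.span ((\<lambda>i. t ^ i) ` {..<p})"
    using t by (simp add: p_basis_def)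
  ultimately show ?thesis
    using frobenius.extension.span_induct [of z "(\<lambda>i. t ^ i) ` {..<p}" ?R] by blast
qed

lemma kaehler_relation_kaehler_functional:
  assumes "p_basis t" "derivation_over emb D" "D t = 1"
  shows "w - Poly_Mapping.single t (kaehler_functional D w) \<in> kaehler_relations emb"
proof (induction w rule: update_induct)
  case const
  show ?case
    by (simp add: kaehler_functional_def zero_in_kaehler_relations)
next
  case (update w z u)
  have "Poly_Mapping.update z u w = w + Poly_Mapping.single z u"
    using update by (intro poly_mapping_eqI)
      (auto simp: lookup_update lookup_add lookup_single when_def in_keys_iff)
  moreover have single: "Poly_Mapping.single z u - Poly_Mapping.single t (u * D z)
      \<in> kaehler_relations emb"
    using kaehler_relations_scale [OF kaehler_relation_derivation [OF assms, of z], of u]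
    by (simp add: kaehler.scale_right_diff_distrib)
  ultimately show ?case
    using kaehler_relations_add [OF update.IH single]
    by (simp add: module_hom.add [OF module_hom_kaehler_functional] single_add algebra_simps)
qed

definition derivation_wrt :: "'a \<Rightarrow> 'a \<Rightarrow> 'a" where
  "derivation_wrt t = (SOME D. derivation_over emb D \<and> D t = 1)"

text \<open>If \<open>t\<close> is a \<open>p\<close>-basis then \<open>\<omega> = u dt\<close> for the class \<open>\<omega>\<close> of \<open>w\<close> and \<open>u = coefficient_wrt t w\<close>.\<close>

abbreviation coefficient_wrt :: "'a \<Rightarrow> ('a \<Rightarrow>\<^sub>0 'a) \<Rightarrow> 'a" where
  "coefficient_wrt t \<equiv> kaehler_functional (derivation_wrt t)"

lemma derivation_wrt:
  assumes "p_basis t"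
  shows "derivation_over emb (derivation_wrt t)" and "derivation_wrt t t = 1"
  using someI_ex [OF ex_derivation [OF assms]] by (simp_all add: derivation_wrt_def)

lemma kaehler_relations_iff:
  assumes "p_basis t"
  shows "w \<in> kaehler_relations emb \<longleftrightarrow> coefficient_wrt t w = 0"
  using derivation_over.kaehler_functional_relation [OF derivation_wrt(1) [OF assms], of w]
    kaehler_relation_kaehler_functional [OF assms derivation_wrt [OF assms], of w]
  by auto

lemma kaehler_class_eq_iff_coefficient:
  "p_basis t \<Longrightarrow> kaehler_class emb v = kaehler_class emb w \<longleftrightarrow>
     coefficient_wrt t v = coefficient_wrt t w"
  by (simp add: kaehler_class_eq_iff kaehler_relations_iff kaehler_functional_diff)

lemma local_coefficient_kaehler_class:
  assumes "P \<in> points emb"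
  shows "local_coefficient emb P (kaehler_class emb w) = coefficient_wrt (uniformizer P) w"
  using p_basis_uniformizer [OF assms]
  by (simp add: local_coefficient_def kaehler_class_eq_iff_coefficient derivation_wrt)

section \<open>Residue codes\<close>

lemma kaehler_class_eq_zero_iff:
  assumes "P \<in> points emb"
  shows "kaehler_class emb w = zero_differential emb \<longleftrightarrow> coefficient_wrt (uniformizer P) w = 0"
  using p_basis_uniformizer [OF assms]
  by (simp add: zero_differential_def kaehler_class_eq_iff kaehler_relations_iff)

abbreviation multiple_class :: "('a \<Rightarrow>\<^sub>0 'a) \<Rightarrow> 'a \<Rightarrow> 'a differential" where
  "multiple_class w f \<equiv> kaehler_class emb (Poly_Mapping.map ((*) f) w)"

lemma differentials_eq_multiples:
  assumes P: "P \<in> points emb" and w: "kaehler_class emb w \<noteq> zero_differential emb"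
  shows "differentials emb = range (multiple_class w)"
proof -
  have "kaehler_class emb v \<in> range (multiple_class w)" for v
  proof
    let ?u = "coefficient_wrt (uniformizer P)"
    show "kaehler_class emb v = multiple_class w (?u v / ?u w)"
      using w by (simp add: kaehler_class_eq_zero_iff [OF P] kaehler_functional_scale
          kaehler_class_eq_iff_coefficient [OF p_basis_uniformizer [OF P]])
  qed simp
  then show ?thesis
    by (auto simp: differentials_def)
qed

lemma differential_order_multiple:
  assumes P: "P \<in> points emb" and w: "kaehler_class emb w \<noteq> zero_differential emb" and "f \<noteq> 0"
  shows "differential_order emb P (multiple_class w f) =
    P f + differential_order emb P (kaehler_class emb w)"
  using assms by (simp add: kaehler_class_eq_zero_iff [OF P] differential_order_def
      local_coefficient_kaehler_class kaehler_functional_scale point_mult)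

lemma differential_space_eq:
  assumes P: "P \<in> points emb" and w: "kaehler_class emb w \<noteq> zero_differential emb"
    and K: "\<forall>Q \<in> points emb.
      Poly_Mapping.lookup K Q = differential_order emb Q (kaehler_class emb w)"
  shows "differential_space emb E = multiple_class w ` riemann_roch_space emb (K - E)"
proof -
  have "multiple_class w f \<in> differential_space emb E \<longleftrightarrow> f \<in> riemann_roch_space emb (K - E)" for f
  proof -
    have "multiple_class w f = zero_differential emb \<longleftrightarrow> f = 0"
      using w by (simp add: kaehler_class_eq_zero_iff [OF P] kaehler_functional_scale)
    then have "multiple_class w f \<in> differential_space emb E \<longleftrightarrow>
        (f \<noteq> 0 \<longrightarrow> (\<forall>Q\<in>points emb. Poly_Mapping.lookup E Q \<le> Q f + Poly_Mapping.lookup K Q))"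
      by (auto simp: differential_space_def differentials_def
          differential_order_multiple [OF _ w] K)
    also have "\<dots> \<longleftrightarrow> f \<in> riemann_roch_space emb (K - E)"
      by (simp add: riemann_roch_space_def lookup_minus algebra_simps)
    finally show ?thesis .
  qed
  moreover have "differential_space emb E \<subseteq> range (multiple_class w)"
    unfolding differentials_eq_multiples [OF P w, symmetric] by (auto simp: differential_space_def)
  ultimately show ?thesis
    by blast
qed

lemma residue_at_multiple:
  assumes rational: "P \<in> rational_points emb"
    and pole: "order_ge P (- 1) (f * coefficient_wrt (uniformizer P) w)"
  shows "residue_at emb P (multiple_class w f) =
    value_at emb P (f * (coefficient_wrt (uniformizer P) w * uniformizer P))"
proof -
  have "local_coefficient emb P (multiple_class w f) = f * coefficient_wrt (uniformizer P) w"
    using rational_point_is_point [OF rational]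
    by (simp add: local_coefficient_kaehler_class kaehler_functional_scale)
  then show ?thesis
    using residue_at_simple_pole [OF rational] pole by (simp add: mult.assoc)
qed

lemma code_Omega_eq_twisted_evaluation_code:
  assumes "distinct Ps" and rational: "set Ps \<subseteq> rational_points emb"
    and disjoint: "Poly_Mapping.keys G \<inter> set Ps = {}"
    and w: "kaehler_class emb w \<noteq> zero_differential emb"
    and K: "\<forall>P \<in> points emb.
      Poly_Mapping.lookup K P = differential_order emb P (kaehler_class emb w)"
  defines "h \<equiv> \<lambda>P. coefficient_wrt (uniformizer P) w * uniformizer P"
  shows "code_Omega emb Ps G = twisted_evaluation_code emb Ps h (points_divisor Ps - (G - K))"
proof (cases "Ps = []")
  case True
  have "kaehler_class emb 0 \<in> differential_space emb (G - points_divisor Ps)"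
    by (simp add: differential_space_def differentials_def zero_differential_def)
  with True show ?thesis
    using zero_in_riemann_roch_space by (auto simp: code_Omega_def twisted_evaluation_code_def)
next
  case False
  then obtain P where "P \<in> points emb"
    using rational rational_point_is_point by (cases Ps) auto
  then have space: "differential_space emb (G - points_divisor Ps) =
      multiple_class w ` riemann_roch_space emb (points_divisor Ps - (G - K))"
    using differential_space_eq [OF _ w K, of P "G - points_divisor Ps"]
    by (simp add: algebra_simps)
  have "residue_at emb P (multiple_class w f) = value_at emb P (f * h P)"
    if P: "P \<in> set Ps" and f: "f \<in> riemann_roch_space emb (points_divisor Ps - (G - K))" for P f
    unfolding h_def
  proof (rule residue_at_multiple)
    show "P \<in> rational_points emb"
      using P rational by blast
    then have pt: "P \<in> points emb"
      by (rule rational_point_is_point)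
    have "Poly_Mapping.lookup G P = 0"
      using P disjoint by (auto simp: in_keys_iff)
    then have "order_ge P (- 1 - Poly_Mapping.lookup K P) f"
      using order_ge_riemann_roch_space [of f "set Ps" "G - K" P] f P pt \<open>distinct Ps\<close>
      by (simp add: points_divisor_eq_reduced_divisor lookup_minus minus_diff_commute [of 1])
    then show "order_ge P (- 1) (f * coefficient_wrt (uniformizer P) w)"
      using w by (simp add: kaehler_class_eq_zero_iff [OF pt] order_ge_mult_iff [OF pt]
          bspec [OF K pt] differential_order_def local_coefficient_kaehler_class [OF pt])
  qed
  then show ?thesis
    unfolding code_Omega_def twisted_evaluation_code_def space image_image
    by (intro image_cong) auto
qed

lemma minimum_distance_code_Omega:
  assumes canonical: "canonical_divisor emb K"
    and "distinct Ps" and rational: "set Ps \<subseteq> rational_points emb"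
    and disjoint: "Poly_Mapping.keys G \<inter> set Ps = {}"
  shows "minimum_distance (code_Omega emb Ps G) =
    least_jump_degree emb (points_divisor Ps) (G - K)"
proof -
  obtain w where w: "kaehler_class emb w \<noteq> zero_differential emb"
    and K: "\<forall>P \<in> points emb.
      Poly_Mapping.lookup K P = differential_order emb P (kaehler_class emb w)"
    using canonical unfolding canonical_divisor_def differentials_def by blast
  let ?u = "\<lambda>P. coefficient_wrt (uniformizer P) w"
  have "?u P * uniformizer P \<noteq> 0 \<and>
      P (?u P * uniformizer P) = 1 - Poly_Mapping.lookup (G - K) P" if "P \<in> set Ps" for P
  proof -
    have P: "P \<in> points emb"
      using that rational rational_point_is_point by blast
    have "?u P \<noteq> 0" "P (?u P) = Poly_Mapping.lookup K P"
      using w by (simp_all add: kaehler_class_eq_zero_iff [OF P] bspec [OF K P]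
          differential_order_def
          local_coefficient_kaehler_class [OF P])
    moreover have "Poly_Mapping.lookup G P = 0"
      using that disjoint by (auto simp: in_keys_iff)
    ultimately show ?thesis
      using uniformizer [OF P] by (simp add: point_mult [OF P] lookup_minus)
  qed
  then show ?thesis
    unfolding code_Omega_eq_twisted_evaluation_code [OF assms(2-4) w K]
    by (rule minimum_distance_twisted_evaluation_code [OF assms(2,3)])
qed

end

theorem proposition2p1:
  fixes emb :: "'k::{field,finite} \<Rightarrow> 'a::field"
    and Ps :: "'a point list"
    and D G K :: "'a divisor"
  assumes "curve_function_field emb"
    and "canonical_divisor emb K"
    and "distinct Ps"
    and "set Ps \<subseteq> rational_points emb"
    and "D = points_divisor Ps"
    and "is_divisor emb G"
    and "Poly_Mapping.keys G \<inter> Poly_Mapping.keys D = {}"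
  shows
    "(let C = D - G in
        minimum_distance (code_L emb Ps G) =
          Inf {enat (nat (divisor_degree emb A)) | A.
             is_divisor emb A \<and> divisor_le 0 A \<and> divisor_le A D \<and>
             riemann_roch_space emb (A - C) \<noteq> riemann_roch_space emb (- C)})
     \<and>
     (let C = G - K in
        minimum_distance (code_Omega emb Ps G) =
          Inf {enat (nat (divisor_degree emb A)) | A.
             is_divisor emb A \<and> divisor_le 0 A \<and> divisor_le A D \<and>
             riemann_roch_space emb (A - C) \<noteq> riemann_roch_space emb (- C)})"
proof -
  have "prime CHAR('k)"
    by (rule prime_CHAR_semidom [OF finite_imp_CHAR_pos]) simp
  then interpret perfect_curve_function_field emb "CHAR('k)"
    using assms(1) surj_frobenius_finite_field
    by (simp add: perfect_curve_function_field_def perfect_curve_function_field_axioms_def)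
  have "Poly_Mapping.keys G \<inter> set Ps = {}"
    using assms(3,5,7) by (simp add: points_divisor_eq_reduced_divisor keys_reduced_divisor)
  then show ?thesis
    using minimum_distance_code_L [OF assms(3,4)] minimum_distance_code_Omega [OF assms(2-4)]
    by (simp add: assms(5) least_jump_degree_def)
qed

end
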